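(* Let $(\Gamma,\mu)$ be a weighted graph as in the context. Assume that $\Gamma$ satisfies the doubling property $(D)$, the Poincaré inequality $(P_q)$ for some $1\le q<+\infty$, and the condition $\Delta(\alpha)$ for some $\alpha>0$. Define $q_0=\inf\{q\in[1,\infty):\ (P_q)\text{ holds}\}$. For $q_0<p_1<p<p_2\le+\infty$, if $\frac1p=\frac{1-\theta}{p_1}+\frac\theta{p_2}$, then $$\dot W^{1,p}(\Gamma)=\left(\dot W^{1,p_1}(\Gamma),\dot W^{1,p_2}(\Gamma)\right)_{\theta,p}$$ (with equivalent norms).
   Context: Setting. $\Gamma$ is an infinite set and $\mu_{xy}=\mu_{yx}\ge 0$ is a symmetric weight on $\Gamma\times\Gamma$. Write $x\sim y$ iff $\mu_{xy}>0$. A path of length $M$ joining $x$ to $y$ is a sequence $x_0=x,\dots,x_M=y$ with $x_i\sim x_{i+1}$ for all $0\le i\le M-1$. $\Gamma$ is assumed connected (any two points are joined by a path), and $d(x,y)$ is the shortest length of a path joining $x$ to $y$. For $r\ge0$, $B(x,r)=\{y\in\Gamma:\ d(x,y)\le r\}$. $\Gamma$ is assumed locally uniformly finite: there is an integer $N_0\ge1$ with $\sharp B(x,1)\le N_0$ for all $x\in\Gamma$. Set $m(x)=\sum_{y\sim x}\mu_{xy}$, assumed $>0$ for all $x$; $m(A)=\sum_{x\in A}m(x)$; $V(x,r)=m(B(x,r))$; $V(B)=m(B)$. For $1\le p<\infty$, $\|f\|_p=(\sum_{x\in\Gamma}|f(x)|^pm(x))^{1/p}$, $\|f\|_\infty=\sup_\Gamma|f|$,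 and $L^p(\Gamma)$ is the corresponding space. Let $p(x,y)=\mu_{xy}/m(x)$ and $\nabla f(x)=\left(\frac12\sum_{y}p(x,y)|f(y)-f(x)|^2\right)^{1/2}$. For $1\le p\le\infty$, $\dot E^{1,p}(\Gamma)$ is the space of scalar functions $f$ on $\Gamma$ with $\nabla f\in L^p(\Gamma)$, with semi-norm $\|\nabla f\|_p$, and $\dot W^{1,p}(\Gamma)=\dot E^{1,p}(\Gamma)/\mathbb R$ is its quotient by the constants, with the corresponding norm. These are Banach spaces, all contained in the space of functions on $\Gamma$ modulo constants. $(A_0,A_1)_{\theta,p}$ denotes real interpolation by the $K$-method: $K(f,t,A_0,A_1)=\inf\{\|a_0\|_{A_0}+t\|a_1\|_{A_1}:\ f=a_0+a_1\}$ and $\|f\|_{\theta,p}=\left(\int_0^\infty(t^{-\theta}K(f,t,A_0,A_1))^p\frac{dt}t\right)^{1/p}$. Convention: $\theta/\infty=0$. Conditions. $(D)$: there is $C>0$ with $V(x,2r)\le CV(x,r)$ for all $x\in\Gamma$, $r>0$. $\Delta(\alpha)$: for all $x,y\in\Gamma$, ($x\sim y\Leftrightarrow \mu_{xy}\ge\alpha m(x)$), and $x\sim x$ for all $x$. $(P_q)$: there is $C>0$ such that for all $x\in\Gamma$, $r>0$ and all functions $f$ on $\Gamma$, with $B=B(x,r)$ and $f_B=\frac1{V(B)}\sum_{z\in B}f(z)m(z)$, one has $\sum_{y\in B}|f(y)-f_B|^qm(y)\le Cr^q\sum_{y\in B}|\nabla f(y)|^qm(y)$. *)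

theory Defs
  imports "HOL-Analysis.Analysis"
begin

section \<open>Weighted graphs\<close>

text \<open>The vertex set \<open>\<Gamma>\<close> is the universe of the type \<open>'a\<close>; the graph is given by its
  weight \<open>\<mu>\<close>.\<close>

definition adj :: "('a \<Rightarrow> 'a \<Rightarrow> real) \<Rightarrow> 'a \<Rightarrow> 'a \<Rightarrow> bool" where
  "adj \<mu> x y \<longleftrightarrow> \<mu> x y > 0"

definition path_joins :: "('a \<Rightarrow> 'a \<Rightarrow> real) \<Rightarrow> nat \<Rightarrow> 'a \<Rightarrow> 'a \<Rightarrow> bool" where
  "path_joins \<mu> M x y \<longleftrightarrow>
     (\<exists>s :: nat \<Rightarrow> 'a. s 0 = x \<and> s M = y \<and> (\<forall>i<M. adj \<mu> (s i) (s (Suc i))))"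

definition gdist :: "('a \<Rightarrow> 'a \<Rightarrow> real) \<Rightarrow> 'a \<Rightarrow> 'a \<Rightarrow> nat" where
  "gdist \<mu> x y = (LEAST M. path_joins \<mu> M x y)"

definition gball :: "('a \<Rightarrow> 'a \<Rightarrow> real) \<Rightarrow> 'a \<Rightarrow> real \<Rightarrow> 'a set" where
  "gball \<mu> x r = {y. real (gdist \<mu> x y) \<le> r}"

definition vweight :: "('a \<Rightarrow> 'a \<Rightarrow> real) \<Rightarrow> 'a \<Rightarrow> real" where
  "vweight \<mu> x = (\<Sum>y | adj \<mu> y x. \<mu> x y)"

locale weighted_graph =
  fixes \<mu> :: "'a \<Rightarrow> 'a \<Rightarrow> real"
  assumes infinite_vertices: "infinite (UNIV :: 'a set)"
    and weight_nonneg: "\<And>x y. \<mu> x y \<ge> 0"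
    and weight_sym: "\<And>x y. \<mu> x y = \<mu> y x"
    and connected_graph: "\<And>x y. \<exists>M. path_joins \<mu> M x y"
    and locally_uniformly_finite:
      "\<exists>N0::nat. N0 \<ge> 1 \<and> (\<forall>x. finite (gball \<mu> x 1) \<and> card (gball \<mu> x 1) \<le> N0)"
    and vweight_pos: "\<And>x. vweight \<mu> x > 0"

text \<open>In a weighted graph all balls are finite, so the finite sums below are the intended ones.\<close>

definition volume :: "('a \<Rightarrow> 'a \<Rightarrow> real) \<Rightarrow> 'a set \<Rightarrow> real" where
  "volume \<mu> A = (\<Sum>x\<in>A. vweight \<mu> x)"

definition trans_prob :: "('a \<Rightarrow> 'a \<Rightarrow> real) \<Rightarrow> 'a \<Rightarrow> 'a \<Rightarrow> real" where
  "trans_prob \<mu> x y = \<mu> x y / vweight \<mu> x"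

text \<open>The sum in the gradient runs over the neighbours of \<open>x\<close> only, since the transition
  probability vanishes elsewhere (and a \<open>sum\<close> over the infinite universe would be \<open>0\<close>).\<close>

definition grad :: "('a \<Rightarrow> 'a \<Rightarrow> real) \<Rightarrow> ('a \<Rightarrow> real) \<Rightarrow> 'a \<Rightarrow> real" where
  "grad \<mu> f x = sqrt (1 / 2 * (\<Sum>y | adj \<mu> x y. trans_prob \<mu> x y * \<bar>f y - f x\<bar>\<^sup>2))"

definition doubling :: "('a \<Rightarrow> 'a \<Rightarrow> real) \<Rightarrow> bool" where
  "doubling \<mu> \<longleftrightarrow>
     (\<exists>C>0. \<forall>x. \<forall>r>0. volume \<mu> (gball \<mu> x (2 * r)) \<le> C * volume \<mu> (gball \<mu> x r))"

definition Delta_cond :: "('a \<Rightarrow> 'a \<Rightarrow> real) \<Rightarrow> real \<Rightarrow> bool" where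
  "Delta_cond \<mu> \<alpha> \<longleftrightarrow>
     (\<forall>x y. adj \<mu> x y \<longleftrightarrow> \<mu> x y \<ge> \<alpha> * vweight \<mu> x) \<and> (\<forall>x. adj \<mu> x x)"

definition mean :: "('a \<Rightarrow> 'a \<Rightarrow> real) \<Rightarrow> 'a set \<Rightarrow> ('a \<Rightarrow> real) \<Rightarrow> real" where
  "mean \<mu> B f = 1 / volume \<mu> B * (\<Sum>z\<in>B. f z * vweight \<mu> z)"

definition poincare :: "('a \<Rightarrow> 'a \<Rightarrow> real) \<Rightarrow> real \<Rightarrow> bool" where
  "poincare \<mu> q \<longleftrightarrow>
     (\<exists>C>0. \<forall>x. \<forall>r>0. \<forall>f :: 'a \<Rightarrow> real.
        (\<Sum>y\<in>gball \<mu> x r. \<bar>f y - mean \<mu> (gball \<mu> x r) f\<bar> powr q * vweight \<mu> y)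
          \<le> C * r powr q * (\<Sum>y\<in>gball \<mu> x r. \<bar>grad \<mu> f y\<bar> powr q * vweight \<mu> y))"

definition poincare_inf :: "('a \<Rightarrow> 'a \<Rightarrow> real) \<Rightarrow> real" where
  "poincare_inf \<mu> = Inf {q. 1 \<le> q \<and> poincare \<mu> q}"


section \<open>Lebesgue and homogeneous Sobolev spaces\<close>

text \<open>Exponents range over the extended reals in \<open>[1, \<infinity>]\<close>. The norms are real-valued and only
  meaningful on the corresponding space.\<close>

definition Lspace :: "('a \<Rightarrow> 'a \<Rightarrow> real) \<Rightarrow> ereal \<Rightarrow> ('a \<Rightarrow> real) set" where
  "Lspace \<mu> p =
     (if p = \<infinity> then {f. bdd_above (range (\<lambda>x. \<bar>f x\<bar>))}
      else {f. (\<lambda>x. \<bar>f x\<bar> powr real_of_ereal p * vweight \<mu> x) summable_on UNIV})"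

definition Lnorm :: "('a \<Rightarrow> 'a \<Rightarrow> real) \<Rightarrow> ereal \<Rightarrow> ('a \<Rightarrow> real) \<Rightarrow> real" where
  "Lnorm \<mu> p f =
     (if p = \<infinity> then (SUP x. \<bar>f x\<bar>)
      else (\<Sum>\<^sub>\<infinity>x. \<bar>f x\<bar> powr real_of_ereal p * vweight \<mu> x) powr (1 / real_of_ereal p))"

definition Espace :: "('a \<Rightarrow> 'a \<Rightarrow> real) \<Rightarrow> ereal \<Rightarrow> ('a \<Rightarrow> real) set" where
  "Espace \<mu> p = {f. grad \<mu> f \<in> Lspace \<mu> p}"

definition Eseminorm :: "('a \<Rightarrow> 'a \<Rightarrow> real) \<Rightarrow> ereal \<Rightarrow> ('a \<Rightarrow> real) \<Rightarrow> real" where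
  "Eseminorm \<mu> p f = Lnorm \<mu> p (grad \<mu> f)"

definition const_rel :: "('a \<Rightarrow> real) \<Rightarrow> ('a \<Rightarrow> real) \<Rightarrow> bool" where
  "const_rel f g \<longleftrightarrow> (\<exists>c. \<forall>x. f x = g x + c)"

lemma equivp_const_rel: "equivp (const_rel :: ('a \<Rightarrow> real) \<Rightarrow> _)"
proof (rule equivpI)
  show "reflp (const_rel :: ('a \<Rightarrow> real) \<Rightarrow> _)"
    by (auto simp: const_rel_def intro!: reflpI exI[of _ 0])
  show "symp (const_rel :: ('a \<Rightarrow> real) \<Rightarrow> _)"
  proof (rule sympI)
    fix f g :: "'a \<Rightarrow> real"
    assume "const_rel f g"
    then obtain c where "\<forall>x. f x = g x + c" by (auto simp: const_rel_def)
    then show "const_rel g f" by (auto simp: const_rel_def intro!: exI[of _ "- c"])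
  qed
  show "transp (const_rel :: ('a \<Rightarrow> real) \<Rightarrow> _)"
  proof (rule transpI)
    fix f g h :: "'a \<Rightarrow> real"
    assume "const_rel f g" "const_rel g h"
    then obtain c d where "\<forall>x. f x = g x + c" "\<forall>x. g x = h x + d"
      by (auto simp: const_rel_def)
    then show "const_rel f h" by (auto simp: const_rel_def intro!: exI[of _ "c + d"])
  qed
qed

text \<open>The space of functions on \<open>\<Gamma>\<close> modulo constants, in which all the spaces
  \<open>Wspace \<mu> p\<close> live.\<close>

quotient_type 'a fun_mod_const = "'a \<Rightarrow> real" / const_rel
  by (rule equivp_const_rel)

instantiation fun_mod_const :: (type) real_vector
begin

lift_definition zero_fun_mod_const :: "'a fun_mod_const" is "\<lambda>_. 0" .

lift_definition plus_fun_mod_const ::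
    "'a fun_mod_const \<Rightarrow> 'a fun_mod_const \<Rightarrow> 'a fun_mod_const"
  is "\<lambda>f g x. f x + g x"
proof -
  fix f f' g g' :: "'a \<Rightarrow> real"
  assume "const_rel f f'" "const_rel g g'"
  then obtain c d where "\<forall>x. f x = f' x + c" "\<forall>x. g x = g' x + d"
    by (auto simp: const_rel_def)
  then show "const_rel (\<lambda>x. f x + g x) (\<lambda>x. f' x + g' x)"
    by (auto simp: const_rel_def intro!: exI[of _ "c + d"])
qed

lift_definition uminus_fun_mod_const :: "'a fun_mod_const \<Rightarrow> 'a fun_mod_const"
  is "\<lambda>f x. - f x"
proof -
  fix f g :: "'a \<Rightarrow> real"
  assume "const_rel f g"
  then obtain c where "\<forall>x. f x = g x + c" by (auto simp: const_rel_def)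
  then show "const_rel (\<lambda>x. - f x) (\<lambda>x. - g x)"
    by (auto simp: const_rel_def intro!: exI[of _ "- c"])
qed

definition minus_fun_mod_const ::
    "'a fun_mod_const \<Rightarrow> 'a fun_mod_const \<Rightarrow> 'a fun_mod_const" where
  "minus_fun_mod_const F G = F + - G"

lift_definition scaleR_fun_mod_const :: "real \<Rightarrow> 'a fun_mod_const \<Rightarrow> 'a fun_mod_const"
  is "\<lambda>a f x. a * f x"
proof -
  fix a and f g :: "'a \<Rightarrow> real"
  assume "const_rel f g"
  then obtain c where "\<forall>x. f x = g x + c" by (auto simp: const_rel_def)
  then show "const_rel (\<lambda>x. a * f x) (\<lambda>x. a * g x)"
    by (auto simp: const_rel_def algebra_simps intro!: exI[of _ "a * c"])
qed

instance
proof
  fix a b :: real and F G H :: "'a fun_mod_const"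
  show "F + G + H = F + (G + H)"
    by transfer (auto simp: const_rel_def intro!: exI[of _ 0])
  show "F + G = G + F"
    by transfer (auto simp: const_rel_def intro!: exI[of _ 0])
  show "0 + F = F"
    by transfer (auto simp: const_rel_def intro!: exI[of _ 0])
  show "- F + F = 0"
    by transfer (auto simp: const_rel_def intro!: exI[of _ 0])
  show "F - G = F + - G"
    by (simp add: minus_fun_mod_const_def)
  show "a *\<^sub>R (F + G) = a *\<^sub>R F + a *\<^sub>R G"
    by transfer (auto simp: const_rel_def algebra_simps intro!: exI[of _ 0])
  show "(a + b) *\<^sub>R F = a *\<^sub>R F + b *\<^sub>R F"
    by transfer (auto simp: const_rel_def algebra_simps intro!: exI[of _ 0])
  show "a *\<^sub>R b *\<^sub>R F = (a * b) *\<^sub>R F"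
    by transfer (auto simp: const_rel_def intro!: exI[of _ 0])
  show "1 *\<^sub>R F = F"
    by transfer (auto simp: const_rel_def intro!: exI[of _ 0])
qed

end

lemma grad_const_rel:
  assumes "const_rel f g"
  shows "grad \<mu> f = grad \<mu> g"
proof -
  obtain c where "\<forall>x. f x = g x + c"
    using assms by (auto simp: const_rel_def)
  then show ?thesis
    by (intro ext) (simp add: grad_def)
qed

definition Wspace :: "('a \<Rightarrow> 'a \<Rightarrow> real) \<Rightarrow> ereal \<Rightarrow> 'a fun_mod_const set" where
  "Wspace \<mu> p = abs_fun_mod_const ` Espace \<mu> p"

lift_definition Wnorm :: "('a \<Rightarrow> 'a \<Rightarrow> real) \<Rightarrow> ereal \<Rightarrow> 'a fun_mod_const \<Rightarrow> real"
  is Eseminorm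
  by (simp add: Eseminorm_def grad_const_rel)


section \<open>Real interpolation by the K-method\<close>

text \<open>A normed space inside an ambient vector space is given by its carrier \<open>A\<close> and its norm
  \<open>N\<close>. The K-functional is only meaningful on the sum of the two spaces.\<close>

definition K_functional ::
    "'v::real_vector set \<Rightarrow> ('v \<Rightarrow> real) \<Rightarrow> 'v set \<Rightarrow> ('v \<Rightarrow> real) \<Rightarrow> 'v \<Rightarrow> real \<Rightarrow> real" where
  "K_functional A0 N0 A1 N1 f t =
     Inf {N0 a0 + t * N1 a1 |a0 a1. a0 \<in> A0 \<and> a1 \<in> A1 \<and> f = a0 + a1}"

definition interp_integral ::
    "'v::real_vector set \<Rightarrow> ('v \<Rightarrow> real) \<Rightarrow> 'v set \<Rightarrow> ('v \<Rightarrow> real) \<Rightarrow> real \<Rightarrow> real \<Rightarrow> 'v \<Rightarrow> ennreal"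
  where
  "interp_integral A0 N0 A1 N1 \<theta> p f =
     (\<integral>\<^sup>+t\<in>{0<..}. ennreal ((t powr (- \<theta>) * K_functional A0 N0 A1 N1 f t) powr p / t) \<partial>lborel)"

definition interp_space ::
    "'v::real_vector set \<Rightarrow> ('v \<Rightarrow> real) \<Rightarrow> 'v set \<Rightarrow> ('v \<Rightarrow> real) \<Rightarrow> real \<Rightarrow> real \<Rightarrow> 'v set"
  where
  "interp_space A0 N0 A1 N1 \<theta> p =
     {f. (\<exists>a0\<in>A0. \<exists>a1\<in>A1. f = a0 + a1) \<and> interp_integral A0 N0 A1 N1 \<theta> p f < \<infinity>}"

definition interp_norm ::
    "'v::real_vector set \<Rightarrow> ('v \<Rightarrow> real) \<Rightarrow> 'v set \<Rightarrow> ('v \<Rightarrow> real) \<Rightarrow> real \<Rightarrow> real \<Rightarrow> 'v \<Rightarrow> real"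
  where
  "interp_norm A0 N0 A1 N1 \<theta> p f =
     enn2real (interp_integral A0 N0 A1 N1 \<theta> p f) powr (1 / p)"

definition equal_with_equivalent_norms ::
    "'v set \<Rightarrow> ('v \<Rightarrow> real) \<Rightarrow> 'v set \<Rightarrow> ('v \<Rightarrow> real) \<Rightarrow> bool" where
  "equal_with_equivalent_norms A N A' N' \<longleftrightarrow>
     A = A' \<and> (\<exists>C>0. \<forall>f\<in>A. N f \<le> C * N' f \<and> N' f \<le> C * N f)"

end

theory Submission imports Defs begin

text \<open>Fix \<open>s < p1\<close> such that \<open>(P_s)\<close> holds and let \<open>h\<close> be the maximum over the neighbours of \<open>x\<close>
  of \<open>(M |\<nabla>f|^s)^(1/s)\<close>, where \<open>M\<close> is the maximal function; by the maximal theorem \<open>h\<close> has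
  \<open>L^p\<close> norm at most a constant times that of \<open>\<nabla>f\<close>. The Poincare inequality and telescoping over
  concentric balls show that \<open>f\<close> is \<open>C l\<close>-Lipschitz on the set where the maximal function is at
  most \<open>l^s\<close>. Since the functions are real-valued, the McShane extension \<open>g\<close> of that restriction
  replaces the Calderon--Zygmund decomposition: \<open>f = (f - g) + g\<close> with \<open>\<nabla>(f - g) \<le> A h 1_{h > l}\<close>
  and \<open>\<nabla>g \<le> A min(h, l)\<close>. This bounds the K-functional of \<open>f\<close> by the one of \<open>h\<close> for the pair
  \<open>(L^p1, L^p2)\<close>. Conversely, \<open>\<nabla>\<close> is subadditive up to a constant, so a decomposition of \<open>f\<close>
  controls the distribution function of \<open>\<nabla>f\<close>.\<close>

section \<open>Sums over discrete sets\<close>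

text \<open>The gradient at x sees every neighbour of x, so the gradient of f - g vanishes at x only
  if all neighbours lie in the good set; this forces the maximum in h, and \<open>Delta_cond\<close>
  keeps its norm under control. The choice s < p leaves p / s > 1, the range where the maximal
  theorem holds for |\<nabla>f|^s. For the upper bound one number per dyadic level must control both
  pieces of the decomposition. A sharp cut-off of the p1-th moment at 2^k can drop to 0 from one
  level to the next, and the values of t attached to the levels would then leave unbounded gaps.
  Hence the smooth weight min(1, (h / 2^k)^N): the resulting number is positive unless h = 0 and
  shrinks at most by the factor 2^N per level. Summing over the levels and exchanging sums returns
  the p-th moment of h, without rearrangements. The lower bound rests on K being nondecreasing and
  K(t) / t nonincreasing, which makes t play the role of a mass variable for the level sets of
  \<nabla>f.\<close>

lemma summable_on_iff_nn_integral:
  fixes f :: "'b \<Rightarrow> real"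
  assumes "\<And>x. f x \<ge> 0"
  shows "f summable_on UNIV \<longleftrightarrow> (\<integral>\<^sup>+x. ennreal (f x) \<partial>count_space UNIV) < \<infinity>"
proof -
  have "f summable_on UNIV \<longleftrightarrow> integrable (count_space UNIV) f"
    by (metis abs_summable_equivalent abs_summable_on_def summable_on_iff_abs_summable_on_real)
  also have "\<dots> \<longleftrightarrow> (\<integral>\<^sup>+x. ennreal (f x) \<partial>count_space UNIV) < \<infinity>"
    using assms by (simp add: integrable_iff_bounded)
  finally show ?thesis .
qed

lemma infsum_eq_nn_integral:
  fixes f :: "'b \<Rightarrow> real"
  assumes "\<And>x. f x \<ge> 0" "f summable_on UNIV"
  shows "ennreal (infsum f UNIV) = (\<integral>\<^sup>+x. ennreal (f x) \<partial>count_space UNIV)"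
proof -
  have abs: "Infinite_Set_Sum.abs_summable_on f UNIV"
    using assms(2) by (metis abs_summable_equivalent summable_on_iff_abs_summable_on_real)
  then have "infsum f UNIV = integral\<^sup>L (count_space UNIV) f"
    by (simp add: infsetsum_infsum [symmetric] infsetsum_def)
  moreover have "integrable (count_space UNIV) f"
    using abs by (simp add: abs_summable_on_def)
  ultimately show ?thesis
    using assms(1) by (simp add: nn_integral_eq_integral)
qed

text \<open>Reduces moment bounds to finite vertex sets, on which volumes are real numbers and
  covering arguments apply; the level sets themselves may be infinite.\<close>

lemma nn_integral_count_space_le_finite_sums:
  fixes f :: "'b \<Rightarrow> real"
  assumes "\<And>x. f x \<ge> 0" and bound: "\<And>E. finite E \<Longrightarrow> ennreal (\<Sum>x\<in>E. f x) \<le> B"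
  shows "(\<integral>\<^sup>+x. ennreal (f x) \<partial>count_space UNIV) \<le> B"
proof (cases B)
  case (real b)
  then have *: "(\<Sum>x\<in>E. f x) \<le> b" if "finite E" for E
    using bound [OF that] by simp
  have sm: "f summable_on UNIV"
    using assms(1) * by (intro nonneg_bdd_above_summable_on) (auto intro!: bdd_aboveI)
  have "infsum f UNIV \<le> b"
    using * by (intro infsum_le_finite_sums sm) auto
  then show ?thesis
    using infsum_eq_nn_integral [OF assms(1) sm] real by (metis ennreal_leI)
qed simp

lemma finite_sum_le_nn_integral_count_space:
  fixes f :: "'b \<Rightarrow> real"
  assumes "\<And>x. f x \<ge> 0" "finite E"
  shows "ennreal (\<Sum>x\<in>E. f x) \<le> (\<integral>\<^sup>+x. ennreal (f x) \<partial>count_space UNIV)"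
proof -
  have "ennreal (\<Sum>x\<in>E. f x) = (\<integral>\<^sup>+x. ennreal (f x) \<partial>count_space E)"
    using assms by (simp add: nn_integral_count_space_finite sum_ennreal)
  also have "\<dots> = (\<integral>\<^sup>+x. ennreal (f x) * indicator E x \<partial>count_space UNIV)"
    by (simp add: nn_integral_count_space_indicator)
  also have "\<dots> \<le> (\<integral>\<^sup>+x. ennreal (f x) \<partial>count_space UNIV)"
    by (intro nn_integral_mono) (auto simp: indicator_def)
  finally show ?thesis .
qed

text \<open>The index 0 is counted twice, which is harmless for an upper bound.\<close>

lemma nn_integral_int_le_nat:
  fixes f :: "int \<Rightarrow> ennreal"
  shows "(\<integral>\<^sup>+k. f k \<partial>count_space UNIV) \<le> (\<Sum>n. f (int n)) + (\<Sum>n. f (- int n))"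
proof -
  have "(\<integral>\<^sup>+k. f k \<partial>count_space UNIV)
      \<le> (\<integral>\<^sup>+k. f k * indicator {0..} k + f k * indicator {..0} k \<partial>count_space UNIV)"
    by (intro nn_integral_mono) (auto simp: indicator_def)
  also have "\<dots> = (\<integral>\<^sup>+k. f k \<partial>count_space {0..}) + (\<integral>\<^sup>+k. f k \<partial>count_space {..0})"
    by (subst nn_integral_add) (auto simp: nn_integral_count_space_indicator)
  also have "(\<integral>\<^sup>+k. f k \<partial>count_space {0..}) = (\<integral>\<^sup>+n. f (int n) \<partial>count_space UNIV)"
    by (rule nn_integral_bij_count_space [symmetric])
       (auto simp: bij_betw_def inj_on_def image_def intro: nonneg_int_cases)
  also have "(\<integral>\<^sup>+k. f k \<partial>count_space {..0}) = (\<integral>\<^sup>+n. f (- int n) \<partial>count_space UNIV)"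
    by (rule nn_integral_bij_count_space [symmetric])
       (auto simp: bij_betw_def inj_on_def image_def intro: nonpos_int_cases)
  finally show ?thesis
    by (simp add: nn_integral_count_space_nat)
qed

lemma dyadic_exponent_exists:
  fixes y :: real
  assumes "y > 0"
  obtains j :: int where "2 powr real_of_int (j - 1) < y" "y \<le> 2 powr real_of_int j"
proof
  show "2 powr real_of_int (\<lceil>log 2 y\<rceil> - 1) < y"
    using assms by (simp add: powr_less_iff) linarith
  show "y \<le> 2 powr real_of_int \<lceil>log 2 y\<rceil>"
    using assms by (simp flip: log_le_iff)
qed

text \<open>For 2^j comparable to y the terms grow like 2^(k \<beta>) up to k = j and decay like
  2^(-k (N - \<beta>)) beyond, so two geometric series dominate. This evaluates the sum over levels
  once it has been exchanged with the sum over vertices.\<close>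

lemma dyadic_sum_bound:
  fixes \<beta> N :: real
  assumes "0 < \<beta>" "\<beta> < N"
  obtains C where "C > 0"
    "\<And>y. y \<ge> 0 \<Longrightarrow> (\<integral>\<^sup>+k. ennreal (2 powr (real_of_int k * \<beta>) * min 1 ((y / 2 powr real_of_int k) powr N))
              \<partial>count_space UNIV) \<le> ennreal (C * y powr \<beta>)"
proof
  \<comment> \<open>\<open>\<gamma>\<close> is the slower of the two decay rates. In
    \<open>C\<close>, the two series give 2 * A and the factor 2^\<beta> comes from 2^j < 2
    y.\<close>
  define \<gamma> where "\<gamma> = min \<beta> (N - \<beta>)"
  define A where "A = 1 / (1 - 2 powr - \<gamma>)"
  define C where "C = 2 * A * 2 powr \<beta>"
  have \<gamma>: "\<gamma> > 0" "\<gamma> \<le> \<beta>" "\<gamma> \<le> N - \<beta>" using assms by (auto simp: \<gamma>_def)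
  have lt1: "2 powr - \<gamma> < 1" using \<gamma> powr_less_mono[of "-\<gamma>" 0 2] by simp
  then have A: "A > 0" by (simp add: A_def)
  then show "C > 0" by (simp add: C_def)
  have geo: "(\<Sum>n. ennreal (2 powr (- \<gamma> * real n))) = ennreal A"
  proof -
    have "2 powr (- \<gamma> * real n) = (2 powr - \<gamma>) ^ n" for n
      by (metis powr_powr powr_realpow powr_gt_zero zero_less_numeral)
    moreover have "(\<lambda>n. (2 powr - \<gamma>) ^ n) sums A"
      unfolding A_def using lt1 by (intro geometric_sums) auto
    ultimately have "(\<lambda>n. 2 powr (- \<gamma> * real n)) sums A" by simp
    then show ?thesis by (intro suminf_ennreal_eq) auto
  qed
  fix y :: real assume y0: "y \<ge> 0"
  show "(\<integral>\<^sup>+k. ennreal (2 powr (real_of_int k * \<beta>) * min 1 ((y / 2 powr real_of_int k) powr N))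
              \<partial>count_space UNIV) \<le> ennreal (C * y powr \<beta>)"
  proof (cases "y = 0")
    case True
    then show ?thesis using assms by simp
  next
    case False
    then have y: "y > 0" using y0 by simp
    obtain j :: int where j: "2 powr real_of_int (j - 1) < y" "y \<le> 2 powr real_of_int j"
      using dyadic_exponent_exists [OF y] .
    have summand: "2 powr (real_of_int (i + j) * \<beta>) * min 1 ((y / 2 powr real_of_int (i + j)) powr N)
        \<le> 2 powr (real_of_int j * \<beta>) * 2 powr (- \<gamma> * \<bar>real_of_int i\<bar>)" for i :: int
    proof -
      have "y / 2 powr real_of_int (i + j) \<le> 2 powr (- real_of_int i)"
        using j(2) by (simp add: powr_add powr_minus field_simps)
      then have "(y / 2 powr real_of_int (i + j)) powr N \<le> (2 powr (- real_of_int i)) powr N"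
        using y assms by (intro powr_mono2) auto
      then have "min 1 ((y / 2 powr real_of_int (i + j)) powr N) \<le> min 1 (2 powr (- real_of_int i * N))"
        unfolding powr_powr by linarith
      moreover have "2 powr (real_of_int i * \<beta>) * min 1 (2 powr (- real_of_int i * N))
          \<le> 2 powr (- \<gamma> * \<bar>real_of_int i\<bar>)"
      proof (cases "i \<ge> 0")
        case True
        have "2 powr (real_of_int i * \<beta>) * min 1 (2 powr (- real_of_int i * N))
          \<le> 2 powr (real_of_int i * \<beta>) * 2 powr (- real_of_int i * N)"
          by (intro mult_left_mono) auto
        also have "\<dots> = 2 powr (- (N - \<beta>) * real_of_int i)"
          by (simp add: powr_add [symmetric] algebra_simps)
        also have "\<dots> \<le> 2 powr (- \<gamma> * real_of_int i)"
          using True \<gamma> by (intro powr_mono mult_right_mono) auto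
        finally show ?thesis using True by simp
      next
        case False
        have "2 powr (real_of_int i * \<beta>) * min 1 (2 powr (- real_of_int i * N))
          \<le> 2 powr (real_of_int i * \<beta>)" by simp
        also have "\<dots> \<le> 2 powr (real_of_int i * \<gamma>)"
          using False \<gamma> by (intro powr_mono mult_left_mono_neg) auto
        finally show ?thesis using False by (simp add: mult.commute)
      qed
      ultimately have "2 powr (real_of_int i * \<beta>) * min 1 ((y / 2 powr real_of_int (i + j)) powr N)
           \<le> 2 powr (- \<gamma> * \<bar>real_of_int i\<bar>)"
        by (meson mult_left_mono order_trans powr_ge_zero)
      then show ?thesis
        by (simp add: distrib_right powr_add mult.assoc mult_left_mono mult.left_commute)
    qed
    have "(\<integral>\<^sup>+k. ennreal (2 powr (real_of_int k * \<beta>) * min 1 ((y / 2 powr real_of_int k) powr N))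
              \<partial>count_space UNIV)
        = (\<integral>\<^sup>+i. ennreal (2 powr (real_of_int (i + j) * \<beta>) * min 1 ((y / 2 powr real_of_int (i + j)) powr N))
              \<partial>count_space UNIV)"
      by (rule nn_integral_bij_count_space [symmetric]) (rule bij_plus_right)
    also have "\<dots> \<le> (\<integral>\<^sup>+i. ennreal (2 powr (real_of_int j * \<beta>)) * ennreal (2 powr (- \<gamma> * \<bar>real_of_int i\<bar>))
              \<partial>count_space UNIV)"
      using summand by (intro nn_integral_mono) (simp flip: ennreal_mult)
    also have "\<dots> = ennreal (2 powr (real_of_int j * \<beta>)) *
        (\<integral>\<^sup>+i. ennreal (2 powr (- \<gamma> * \<bar>real_of_int i\<bar>)) \<partial>count_space UNIV)"
      by (rule nn_integral_cmult) simp
    also have "\<dots> \<le> ennreal (2 powr (real_of_int j * \<beta>)) * (ennreal A + ennreal A)"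
      using nn_integral_int_le_nat [of "\<lambda>i. ennreal (2 powr (- \<gamma> * \<bar>real_of_int i\<bar>))"] geo
      by (intro mult_left_mono) auto
    also have "\<dots> = ennreal (2 powr (real_of_int j * \<beta>) * (2 * A))"
      using A by (simp flip: ennreal_plus ennreal_mult)
    also have "2 powr (real_of_int j * \<beta>) = 2 powr \<beta> * (2 powr real_of_int (j - 1)) powr \<beta>"
      unfolding powr_powr powr_add [symmetric] by (simp add: algebra_simps)
    also have "ennreal (2 powr \<beta> * (2 powr real_of_int (j - 1)) powr \<beta> * (2 * A)) \<le> ennreal (C * y powr \<beta>)"
    proof (rule ennreal_leI)
      have "(2 powr real_of_int (j - 1)) powr \<beta> \<le> y powr \<beta>"
        using j assms by (intro powr_mono2) auto
      then have "2 powr \<beta> * (2 * A) * (2 powr real_of_int (j - 1)) powr \<beta> \<le> 2 powr \<beta> * (2 * A) * y powr \<beta>"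
        using A by (intro mult_left_mono) auto
      then show "2 powr \<beta> * (2 powr real_of_int (j - 1)) powr \<beta> * (2 * A) \<le> C * y powr \<beta>"
        by (simp add: C_def algebra_simps)
    qed
    finally show ?thesis .
  qed
qed

section \<open>Weighted graphs\<close>

context weighted_graph
begin

lemma adj_sym: "adj \<mu> x y \<longleftrightarrow> adj \<mu> y x"
  using weight_sym by (simp add: adj_def)

lemma path_joins_gdist: "path_joins \<mu> (gdist \<mu> x y) x y"
  unfolding gdist_def using connected_graph by (rule LeastI_ex)

lemma gdist_le: "path_joins \<mu> M x y \<Longrightarrow> gdist \<mu> x y \<le> M"
  unfolding gdist_def by (rule Least_le)

lemma path_joins_append:
  assumes "path_joins \<mu> M x y" "path_joins \<mu> N y z"
  shows "path_joins \<mu> (M + N) x z"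
proof -
  obtain s where s: "s 0 = x" "s M = y" "\<And>i. i < M \<Longrightarrow> adj \<mu> (s i) (s (Suc i))"
    using assms(1) by (auto simp: path_joins_def)
  obtain t where t: "t 0 = y" "t N = z" "\<And>i. i < N \<Longrightarrow> adj \<mu> (t i) (t (Suc i))"
    using assms(2) by (auto simp: path_joins_def)
  define u where "u i = (if i \<le> M then s i else t (i - M))" for i
  have "adj \<mu> (u i) (u (Suc i))" if "i < M + N" for i
  proof -
    consider "i < M" | "i = M" | "i > M" by linarith
    then show ?thesis
    proof cases
      case 2
      then show ?thesis using t(1) t(3)[of 0] s that by (simp add: u_def)
    next
      case 3
      then show ?thesis using t(3)[of "i - M"] that by (simp add: u_def Suc_diff_le)
    qed (simp add: u_def s)
  qed
  moreover have "u 0 = x" "u (M + N) = z"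
    using s t by (auto simp: u_def)
  ultimately show ?thesis
    unfolding path_joins_def by blast
qed

lemma path_joins_rev:
  assumes "path_joins \<mu> M x y"
  shows "path_joins \<mu> M y x"
proof -
  obtain s where s: "s 0 = x" "s M = y" "\<And>i. i < M \<Longrightarrow> adj \<mu> (s i) (s (Suc i))"
    using assms by (auto simp: path_joins_def)
  have "adj \<mu> (s (M - i)) (s (M - Suc i))" if "i < M" for i
    using s(3) [of "M - Suc i"] that by (simp add: Suc_diff_Suc adj_sym)
  then show ?thesis
    unfolding path_joins_def using s by (intro exI [of _ "\<lambda>i. s (M - i)"]) auto
qed

lemma gdist_commute: "gdist \<mu> x y = gdist \<mu> y x"
  by (meson antisym gdist_le path_joins_gdist path_joins_rev)

lemma gdist_triangle: "gdist \<mu> x z \<le> gdist \<mu> x y + gdist \<mu> y z"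
  by (meson gdist_le path_joins_append path_joins_gdist)

lemma gdist_eq_0_iff [simp]: "gdist \<mu> x y = 0 \<longleftrightarrow> x = y"
proof
  show "gdist \<mu> x y = 0 \<Longrightarrow> x = y"
    using path_joins_gdist [of x y] by (auto simp: path_joins_def)
  have "path_joins \<mu> 0 x x"
    by (auto simp: path_joins_def)
  then show "x = y \<Longrightarrow> gdist \<mu> x y = 0"
    using gdist_le [of 0 x x] by simp
qed

lemma gdist_self [simp]: "gdist \<mu> x x = 0"
  by simp

lemma gdist_adj_le: "adj \<mu> x y \<Longrightarrow> gdist \<mu> x y \<le> 1"
  by (intro gdist_le) (auto simp: path_joins_def intro!: exI [of _ "\<lambda>i. if i = 0 then x else y"])

lemma centre_in_gball [simp]: "r \<ge> 0 \<Longrightarrow> x \<in> gball \<mu> x r"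
  by (simp add: gball_def)

lemma gball_lt_1: "0 \<le> r \<Longrightarrow> r < 1 \<Longrightarrow> gball \<mu> x r = {x}"
proof -
  assume r: "0 \<le> r" "r < 1"
  have "x = y" if "real (gdist \<mu> x y) \<le> r" for y
  proof -
    have "gdist \<mu> x y = 0" using that r by linarith
    then show ?thesis by simp
  qed
  then show ?thesis
    using r by (auto simp: gball_def)
qed

lemma gball_subset:
  assumes "real (gdist \<mu> x y) + r \<le> R"
  shows "gball \<mu> y r \<subseteq> gball \<mu> x R"
proof
  fix z assume "z \<in> gball \<mu> y r"
  then show "z \<in> gball \<mu> x R"
    using gdist_triangle [of x z y] assms by (simp add: gball_def)
qed

text \<open>Local finiteness concerns radius 1 only. The last but one vertex of a shortest path
  shows that unit balls centred in the ball of radius n cover the ball of radius n + 1.\<close>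

lemma finite_gball [simp]: "finite (gball \<mu> x r)"
proof -
  have fin1: "finite (gball \<mu> y 1)" for y
    using locally_uniformly_finite by auto
  have "finite (gball \<mu> x (real n))" for n :: nat
  proof (induction n)
    case 0
    then show ?case by (simp add: gball_lt_1)
  next
    case (Suc n)
    have "gball \<mu> x (real (Suc n)) \<subseteq> (\<Union>y\<in>gball \<mu> x (real n). gball \<mu> y 1)"
    proof
      fix z assume "z \<in> gball \<mu> x (real (Suc n))"
      then have le: "gdist \<mu> x z \<le> Suc n" by (simp add: gball_def)
      obtain s where s: "s 0 = x" "s (gdist \<mu> x z) = z"
          "\<And>i. i < gdist \<mu> x z \<Longrightarrow> adj \<mu> (s i) (s (Suc i))"
        using path_joins_gdist [of x z] by (auto simp: path_joins_def)
      have "path_joins \<mu> i x (s i)" if "i \<le> gdist \<mu> x z" for i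
        unfolding path_joins_def using s that by (intro exI [of _ s]) auto
      then have "gdist \<mu> x (s (gdist \<mu> x z - 1)) \<le> n"
        using gdist_le [of "gdist \<mu> x z - 1" x "s (gdist \<mu> x z - 1)"] le by simp
      \<comment> \<open>At distance 0 truncated subtraction gives the index 0, and the vertex is z
        itself.\<close>
      moreover have "gdist \<mu> (s (gdist \<mu> x z - 1)) z \<le> 1"
        using gdist_adj_le s(3) [of "gdist \<mu> x z - 1"] s(1,2)
        by (cases "gdist \<mu> x z = 0") (auto simp del: One_nat_def)
      ultimately show "z \<in> (\<Union>y\<in>gball \<mu> x (real n). gball \<mu> y 1)"
        by (auto simp: gball_def)
    qed
    then show ?case
      using Suc fin1 by (meson finite_UN_I finite_subset)
  qed
  moreover have "gball \<mu> x r \<subseteq> gball \<mu> x (real (nat \<lceil>r\<rceil>))"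
    by (auto simp: gball_def) linarith
  ultimately show ?thesis
    using finite_subset by blast
qed

lemma finite_neighbours [simp]: "finite {y. adj \<mu> x y}"
  by (rule finite_subset [of _ "gball \<mu> x 1"]) (use locally_uniformly_finite gdist_adj_le in \<open>auto simp: gball_def\<close>)

lemma vweight_eq: "vweight \<mu> x = (\<Sum>y | adj \<mu> x y. \<mu> x y)"
  unfolding vweight_def using adj_sym by (intro sum.cong) auto

lemma volume_pos: "0 \<le> r \<Longrightarrow> volume \<mu> (gball \<mu> x r) > 0"
  unfolding volume_def using vweight_pos centre_in_gball [of r x] by (intro sum_pos) (auto simp del: centre_in_gball)

lemma volume_mono: "A \<subseteq> B \<Longrightarrow> finite B \<Longrightarrow> volume \<mu> A \<le> volume \<mu> B"
  unfolding volume_def using vweight_pos by (intro sum_mono2) (auto intro: less_imp_le)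

lemma grad_nonneg [simp]: "grad \<mu> f x \<ge> 0"
  by (auto simp: grad_def trans_prob_def intro!: sum_nonneg mult_nonneg_nonneg divide_nonneg_pos
      weight_nonneg vweight_pos)

lemma trans_prob_nonneg [simp]: "trans_prob \<mu> x y \<ge> 0"
  using weight_nonneg vweight_pos by (simp add: trans_prob_def less_imp_le)

lemma sum_trans_prob: "(\<Sum>y | adj \<mu> x y. trans_prob \<mu> x y) = 1"
  using vweight_pos [of x] unfolding trans_prob_def
  by (simp add: sum_divide_distrib [symmetric] vweight_eq [symmetric])

lemma grad_cong:
  assumes "\<And>y. adj \<mu> x y \<Longrightarrow> f y - f x = g y - g x"
  shows "grad \<mu> f x = grad \<mu> g x"
  using assms by (simp add: grad_def)

text \<open>The transition probabilities out of x add up to 1, so the sum under the root is half a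
  weighted mean of squared differences.\<close>

lemma grad_le:
  assumes "\<And>y. adj \<mu> x y \<Longrightarrow> \<bar>f y - f x\<bar> \<le> L" "L \<ge> 0"
  shows "grad \<mu> f x \<le> L"
proof -
  have "(\<Sum>y | adj \<mu> x y. trans_prob \<mu> x y * \<bar>f y - f x\<bar>\<^sup>2) \<le> (\<Sum>y | adj \<mu> x y. trans_prob \<mu> x y * L\<^sup>2)"
    using assms by (intro sum_mono mult_left_mono power_mono) auto
  also have "\<dots> = L\<^sup>2"
    by (simp add: sum_distrib_right [symmetric] sum_trans_prob)
  finally show ?thesis
    using assms(2) zero_le_power2 [of L] unfolding grad_def by (intro real_le_lsqrt) linarith+
qed

text \<open>Follows from (a + b)^2 \<le> 2 a^2 + 2 b^2 under the sum; the factor 2 only enters the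
  constants of the norm equivalence.\<close>

lemma grad_add_le: "grad \<mu> (\<lambda>x. f x + g x) x \<le> 2 * (grad \<mu> f x + grad \<mu> g x)"
proof -
  let ?S = "\<lambda>f. \<Sum>y | adj \<mu> x y. trans_prob \<mu> x y * \<bar>f y - f x\<bar>\<^sup>2"
  have S: "?S f = 2 * (grad \<mu> f x)\<^sup>2" for f
    unfolding grad_def by (subst real_sqrt_pow2) (auto intro!: sum_nonneg)
  have "?S (\<lambda>x. f x + g x) \<le>
      (\<Sum>y | adj \<mu> x y. 2 * (trans_prob \<mu> x y * \<bar>f y - f x\<bar>\<^sup>2) + 2 * (trans_prob \<mu> x y * \<bar>g y - g x\<bar>\<^sup>2))"
  proof (rule sum_mono)
    fix y
    have "(f y + g y - (f x + g x))\<^sup>2 \<le> 2 * (f y - f x)\<^sup>2 + 2 * (g y - g x)\<^sup>2"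
      using zero_le_power2 [of "(f y - f x) - (g y - g x)"]
      by (simp add: power2_eq_square algebra_simps)
    then have "trans_prob \<mu> x y * (f y + g y - (f x + g x))\<^sup>2
        \<le> trans_prob \<mu> x y * (2 * (f y - f x)\<^sup>2 + 2 * (g y - g x)\<^sup>2)"
      by (rule mult_left_mono) simp
    then show "trans_prob \<mu> x y * \<bar>f y + g y - (f x + g x)\<bar>\<^sup>2
      \<le> 2 * (trans_prob \<mu> x y * \<bar>f y - f x\<bar>\<^sup>2) + 2 * (trans_prob \<mu> x y * \<bar>g y - g x\<bar>\<^sup>2)"
      by (simp add: algebra_simps)
  qed
  also have "\<dots> = 2 * ?S f + 2 * ?S g"
    by (simp add: sum.distrib sum_distrib_left)
  finally have "(grad \<mu> (\<lambda>x. f x + g x) x)\<^sup>2 \<le> 2 * (grad \<mu> f x)\<^sup>2 + 2 * (grad \<mu> g x)\<^sup>2"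
    using S [of "\<lambda>x. f x + g x"] S [of f] S [of g] by linarith
  also have "\<dots> \<le> (2 * (grad \<mu> f x + grad \<mu> g x))\<^sup>2"
    using mult_nonneg_nonneg [OF grad_nonneg [of f x] grad_nonneg [of g x]]
      zero_le_power2 [of "grad \<mu> f x"] zero_le_power2 [of "grad \<mu> g x"]
    by (simp add: power2_eq_square algebra_simps)
  finally show ?thesis
    by (rule power2_le_imp_le) simp
qed

lemma grad_uminus: "grad \<mu> (\<lambda>x. - f x) = grad \<mu> f"
proof
  have "\<bar>- f y + f x\<bar> = \<bar>f y - f x\<bar>" for x y :: 'a by linarith
  then show "grad \<mu> (\<lambda>x. - f x) x = grad \<mu> f x" for x
    by (simp add: grad_def)
qed

lemma grad_diff_le: "grad \<mu> (\<lambda>x. f x - g x) x \<le> 2 * (grad \<mu> f x + grad \<mu> g x)"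
  using grad_add_le [of f "\<lambda>x. - g x" x] by (simp add: grad_uminus)

text \<open>McShane's construction: the lower envelope of the cones of slope L whose vertices lie on
  the graph of f over E.\<close>

lemma lipschitz_extension:
  assumes lip: "\<And>x y. x \<in> E \<Longrightarrow> y \<in> E \<Longrightarrow> \<bar>f x - f y\<bar> \<le> L * real (gdist \<mu> x y)" and "L \<ge> 0"
  obtains g where "\<And>x. x \<in> E \<Longrightarrow> g x = f x"
    "\<And>x y. \<bar>g x - g y\<bar> \<le> L * real (gdist \<mu> x y)"
proof (cases "E = {}")
  \<comment> \<open>An infimum over the empty set has no usable value; any constant function serves
    here.\<close>
  case True
  then show ?thesis using that [of "\<lambda>_. 0"] \<open>L \<ge> 0\<close> by simp
next
  case False
  then obtain e where e: "e \<in> E" by blast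
  define g where "g y = (INF x\<in>E. f x + L * real (gdist \<mu> x y))" for y
  have tri: "L * real (gdist \<mu> x z) \<le> L * real (gdist \<mu> x y) + L * real (gdist \<mu> y z)" for x y z
    using mult_left_mono [OF of_nat_mono [OF gdist_triangle [of x z y]], of L] \<open>L \<ge> 0\<close>
    by (simp add: distrib_left)
  \<comment> \<open>The cone at the fixed point e, turned downwards, lies below all the
    others.\<close>
  have bdd: "bdd_below ((\<lambda>x. f x + L * real (gdist \<mu> x y)) ` E)" for y
  proof (rule bdd_belowI2)
    fix x assume "x \<in> E"
    then show "f e - L * real (gdist \<mu> e y) \<le> f x + L * real (gdist \<mu> x y)"
      using lip [OF e \<open>x \<in> E\<close>] tri [of e x y] gdist_commute [of x y] by (simp add: abs_le_iff)
  qed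
  have le: "g y \<le> g z + L * real (gdist \<mu> y z)" for y z
  proof -
    have "g y - L * real (gdist \<mu> y z) \<le> g z"
      unfolding g_def [of z]
    proof (rule cINF_greatest)
      fix x assume x: "x \<in> E"
      have "g y \<le> f x + L * real (gdist \<mu> x y)"
        unfolding g_def by (rule cINF_lower [OF bdd x])
      then show "g y - L * real (gdist \<mu> y z) \<le> f x + L * real (gdist \<mu> x z)"
        using tri [of x y z] gdist_commute [of y z] by simp
    qed (use False in auto)
    then show ?thesis by simp
  qed
  show ?thesis
  proof (rule that)
    fix x assume x: "x \<in> E"
    have "g x \<le> f x + L * real (gdist \<mu> x x)"
      unfolding g_def by (rule cINF_lower [OF bdd x])
    moreover have "f x \<le> g x"
      unfolding g_def
    proof (rule cINF_greatest)
      fix z assume "z \<in> E"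
      then show "f x \<le> f z + L * real (gdist \<mu> z x)"
        using lip [OF \<open>z \<in> E\<close> x] by linarith
    qed (use False in auto)
    ultimately show "g x = f x" by simp
  next
    fix x y
    show "\<bar>g x - g y\<bar> \<le> L * real (gdist \<mu> x y)"
      using le [of x y] le [of y x] gdist_commute [of x y] by simp
  qed
qed

end

section \<open>The maximal function\<close>

text \<open>The p-th power of the weighted p-norm, with values in [0, \<infinity>] so that sums over
  vertices, sums over levels and integrals in t can be exchanged without summability
  conditions.\<close>

definition moment :: "('a \<Rightarrow> 'a \<Rightarrow> real) \<Rightarrow> real \<Rightarrow> ('a \<Rightarrow> real) \<Rightarrow> ennreal" where
  "moment \<mu> p f = (\<integral>\<^sup>+x. ennreal (\<bar>f x\<bar> powr p * vweight \<mu> x) \<partial>count_space UNIV)"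

definition average :: "('a \<Rightarrow> 'a \<Rightarrow> real) \<Rightarrow> ('a \<Rightarrow> real) \<Rightarrow> 'a \<Rightarrow> real \<Rightarrow> real" where
  "average \<mu> f x r = (\<Sum>y\<in>gball \<mu> x r. f y * vweight \<mu> y) / volume \<mu> (gball \<mu> x r)"

text \<open>The centred Hardy-Littlewood maximal function of a nonnegative f. The real supremum is
  meaningful where the averages are bounded, see \<open>average_bdd_above\<close>.\<close>

definition maximal_function :: "('a \<Rightarrow> 'a \<Rightarrow> real) \<Rightarrow> ('a \<Rightarrow> real) \<Rightarrow> 'a \<Rightarrow> real" where
  "maximal_function \<mu> f x = (SUP r\<in>{0<..}. average \<mu> f x r)"

context weighted_graph
begin

lemma vweight_nonneg [simp]: "vweight \<mu> x \<ge> 0"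
  using vweight_pos by (rule less_imp_le)

lemma finite_sum_le_moment:
  "finite E \<Longrightarrow> ennreal (\<Sum>x\<in>E. \<bar>f x\<bar> powr p * vweight \<mu> x) \<le> moment \<mu> p f"
  unfolding moment_def by (rule finite_sum_le_nn_integral_count_space) auto

text \<open>By u \<le> 1 + u^P an average is at most 1 plus the P-th moment over the volume, and
  every ball about x has at least the mass of x.\<close>

lemma average_bdd_above:
  assumes "\<And>y. f y \<ge> 0" "P \<ge> 1" "moment \<mu> P f < \<infinity>"
  shows "bdd_above (average \<mu> f x ` {0<..})"
proof -
  obtain I where I: "moment \<mu> P f = ennreal I" "I \<ge> 0"
    using assms(3) by (cases "moment \<mu> P f") auto
  have "average \<mu> f x r \<le> 1 + I / vweight \<mu> x" if "r > 0" for r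
  proof -
    let ?B = "gball \<mu> x r"
    have V: "vweight \<mu> x \<le> volume \<mu> ?B"
      using volume_mono [of "{x}" ?B] that by (simp add: volume_def)
    have le: "u \<le> 1 + u powr P" if "u \<ge> 0" for u :: real
    proof (cases "u \<le> 1")
      case False
      then have "u powr 1 \<le> u powr P" using assms(2) by (intro powr_mono) auto
      then show ?thesis using False by simp
    qed (simp add: add_increasing2)
    have "(\<Sum>y\<in>?B. f y * vweight \<mu> y) \<le> (\<Sum>y\<in>?B. (1 + \<bar>f y\<bar> powr P) * vweight \<mu> y)"
      using assms(1) le by (intro sum_mono mult_right_mono) auto
    also have "\<dots> = volume \<mu> ?B + (\<Sum>y\<in>?B. \<bar>f y\<bar> powr P * vweight \<mu> y)"
      by (simp add: distrib_right sum.distrib volume_def)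
    also have "(\<Sum>y\<in>?B. \<bar>f y\<bar> powr P * vweight \<mu> y) \<le> I"
      using finite_sum_le_moment [of ?B f P] I by simp
    finally have "average \<mu> f x r \<le> (volume \<mu> ?B + I) / volume \<mu> ?B"
      unfolding average_def using volume_pos [of r x] that by (intro divide_right_mono) auto
    also have "\<dots> = 1 + I / volume \<mu> ?B"
      using volume_pos [of r x] that by (simp add: add_divide_distrib)
    also have "\<dots> \<le> 1 + I / vweight \<mu> x"
      using V I vweight_pos by (intro add_left_mono divide_left_mono mult_pos_pos less_le_trans [OF vweight_pos V]) auto
    finally show ?thesis .
  qed
  then show ?thesis
    by (intro bdd_aboveI2) auto
qed

lemma average_le_maximal_function:
  assumes "\<And>y. f y \<ge> 0" "P \<ge> 1" "moment \<mu> P f < \<infinity>" "r > 0"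
  shows "average \<mu> f x r \<le> maximal_function \<mu> f x"
  unfolding maximal_function_def using assms(4)
  by (intro cSUP_upper average_bdd_above [OF assms(1-3)]) auto

text \<open>A ball of radius 1/2 is a single vertex, so f x is itself one of the averages.\<close>

lemma le_maximal_function:
  assumes "\<And>y. f y \<ge> 0" "P \<ge> 1" "moment \<mu> P f < \<infinity>"
  shows "f x \<le> maximal_function \<mu> f x"
  using average_le_maximal_function [OF assms, of "1/2" x] vweight_pos [of x]
  by (simp add: average_def gball_lt_1 volume_def)

lemma less_maximal_functionD:
  assumes "\<And>y. f y \<ge> 0" "P \<ge> 1" "moment \<mu> P f < \<infinity>" "l < maximal_function \<mu> f x"
  obtains r where "r > 0" "l < average \<mu> f x r"
  using assms(4) less_cSUP_iff [OF _ average_bdd_above [OF assms(1-3), of x], of l]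
  unfolding maximal_function_def by auto

text \<open>Greedy selection by largest radius. Only the centres have to be covered: if the ball of
  x meets a ball of z with r x \<le> r z, then x is within 2 r z of z. Dilation by 2 costs a single
  use of doubling.\<close>

lemma vitali_covering_finite:
  fixes r :: "'a \<Rightarrow> real"
  assumes "finite E" "\<And>x. x \<in> E \<Longrightarrow> r x > 0"
  shows "\<exists>D\<subseteq>E. disjoint_family_on (\<lambda>x. gball \<mu> x (r x)) D \<and> E \<subseteq> (\<Union>x\<in>D. gball \<mu> x (2 * r x))"
  using assms
proof (induction E rule: finite_psubset_induct)
  case (psubset E)
  show ?case
  proof (cases "E = {}")
    case False
    then have "Max (r ` E) \<in> r ` E" using psubset.hyps by (intro Max_in) auto
    then obtain z where z: "z \<in> E" "r z = Max (r ` E)" by auto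
    have max: "r x \<le> r z" if "x \<in> E" for x
      using that z psubset.hyps by simp
    define E' where "E' = {x\<in>E. gball \<mu> x (r x) \<inter> gball \<mu> z (r z) = {}}"
    have "z \<notin> E'"
      using psubset.prems [OF z(1)] centre_in_gball [of "r z" z] by (auto simp: E'_def simp del: centre_in_gball)
    then have "E' \<subset> E" using z(1) unfolding E'_def by blast
    then obtain D where D: "D \<subseteq> E'" "disjoint_family_on (\<lambda>x. gball \<mu> x (r x)) D"
        "E' \<subseteq> (\<Union>x\<in>D. gball \<mu> x (2 * r x))"
      using psubset.IH [of E'] psubset.prems by (auto simp: E'_def)
    have "disjoint_family_on (\<lambda>x. gball \<mu> x (r x)) (insert z D)"
      using D(1,2) by (auto simp: disjoint_family_on_def E'_def)
    moreover have "x \<in> gball \<mu> z (2 * r z)" if x: "x \<in> E" "x \<notin> E'" for x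
    proof -
      obtain w where "w \<in> gball \<mu> x (r x)" "w \<in> gball \<mu> z (r z)"
        using x by (auto simp: E'_def)
      then show ?thesis
        using gdist_triangle [of z x w] gdist_commute [of x w] max [OF x(1)]
        by (simp add: gball_def)
    qed
    then have "E \<subseteq> (\<Union>x\<in>insert z D. gball \<mu> x (2 * r x))"
      using D(3) by auto
    moreover have "insert z D \<subseteq> E"
      using D(1) z(1) by (auto simp: E'_def)
    ultimately show ?thesis by blast
  qed (auto simp: disjoint_family_on_def)
qed

lemma volume_Un_le:
  assumes "finite A" "finite B"
  shows "volume \<mu> (A \<union> B) \<le> volume \<mu> A + volume \<mu> B"
  using sum.union_inter [OF assms, of "vweight \<mu>"] sum_nonneg [of "A \<inter> B" "vweight \<mu>"]
  by (simp add: volume_def)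

text \<open>Values of f up to l / 2 cannot account for more than half of an average above l, so only
  the larger ones appear on the right. This truncated form can be summed over dyadic l; with all of
  f on the right the sum over levels would diverge.\<close>

lemma maximal_function_weak_type:
  assumes doubling: "\<And>x r. r > 0 \<Longrightarrow> volume \<mu> (gball \<mu> x (2 * r)) \<le> C * volume \<mu> (gball \<mu> x r)"
    and "C > 0" and f: "\<And>y. f y \<ge> 0" "P \<ge> 1" "moment \<mu> P f < \<infinity>"
    and "finite E" "\<And>x. x \<in> E \<Longrightarrow> l < maximal_function \<mu> f x" "l > 0"
  shows "ennreal (volume \<mu> E) \<le> ennreal (2 * C / l) *
    (\<integral>\<^sup>+y. ennreal (of_bool (f y > l / 2) * f y * vweight \<mu> y) \<partial>count_space UNIV)"
proof -
  let ?g = "\<lambda>y. of_bool (f y > l / 2) * f y * vweight \<mu> y"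
  have "\<exists>r>0. l < average \<mu> f x r" if "x \<in> E" for x
    using less_maximal_functionD [OF f assms(7) [OF that]] by blast
  then obtain r where r: "\<And>x. x \<in> E \<Longrightarrow> r x > 0" "\<And>x. x \<in> E \<Longrightarrow> l < average \<mu> f x (r x)"
    by metis
  obtain D where D: "D \<subseteq> E" "disjoint_family_on (\<lambda>x. gball \<mu> x (r x)) D"
        "E \<subseteq> (\<Union>x\<in>D. gball \<mu> x (2 * r x))"
    using vitali_covering_finite [of E r] r(1) \<open>finite E\<close> by blast
  have finD: "finite D" using D(1) \<open>finite E\<close> finite_subset by blast
  have V: "l / 2 * volume \<mu> (gball \<mu> x (r x)) \<le> (\<Sum>y\<in>gball \<mu> x (r x). ?g y)" if "x \<in> D" for x
  proof -
    let ?B = "gball \<mu> x (r x)"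
    have x: "x \<in> E" using that D by auto
    have "l * volume \<mu> ?B \<le> (\<Sum>y\<in>?B. f y * vweight \<mu> y)"
      using r(2) [OF x] volume_pos [of "r x" x] r(1) [OF x] by (simp add: average_def field_simps)
    also have "\<dots> \<le> (\<Sum>y\<in>?B. ?g y + l / 2 * vweight \<mu> y)"
    proof (rule sum_mono)
      fix y
      have "f y \<le> of_bool (f y > l / 2) * f y + l / 2"
        using f(1) [of y] \<open>l > 0\<close> by simp
      from mult_right_mono [OF this vweight_nonneg [of y]]
      show "f y * vweight \<mu> y \<le> ?g y + l / 2 * vweight \<mu> y"
        by (simp add: distrib_right)
    qed
    also have "\<dots> = (\<Sum>y\<in>?B. ?g y) + l / 2 * volume \<mu> ?B"
      by (simp add: sum.distrib volume_def sum_distrib_left)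
    finally show ?thesis by simp
  qed
  have "volume \<mu> E \<le> volume \<mu> (\<Union>x\<in>D. gball \<mu> x (2 * r x))"
    using D(3) finD by (intro volume_mono) auto
  also have "\<dots> \<le> (\<Sum>x\<in>D. volume \<mu> (gball \<mu> x (2 * r x)))"
    using finD
  proof (induction D)
    case (insert a D)
    then show ?case
      using insert.IH insert.hyps
      by (simp add: order_trans [OF volume_Un_le])
  qed (simp add: volume_def)
  also have "\<dots> \<le> (\<Sum>x\<in>D. C * volume \<mu> (gball \<mu> x (r x)))"
    using D(1) r(1) by (intro sum_mono doubling) auto
  also have "\<dots> = (\<Sum>x\<in>D. 2 * C / l * (l / 2 * volume \<mu> (gball \<mu> x (r x))))"
    using \<open>l > 0\<close> by simp
  also have "\<dots> \<le> (\<Sum>x\<in>D. 2 * C / l * (\<Sum>y\<in>gball \<mu> x (r x). ?g y))"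
    using V \<open>C > 0\<close> \<open>l > 0\<close> by (intro sum_mono mult_left_mono) auto
  also have "\<dots> = 2 * C / l * (\<Sum>y\<in>(\<Union>x\<in>D. gball \<mu> x (r x)). ?g y)"
    using D(2) finD
    by (subst sum.UNION_disjoint) (auto simp: disjoint_family_on_def sum_distrib_left)
  finally have "ennreal (volume \<mu> E) \<le> ennreal (2 * C / l * (\<Sum>y\<in>(\<Union>x\<in>D. gball \<mu> x (r x)). ?g y))"
    by (rule ennreal_leI)
  also have "\<dots> = ennreal (2 * C / l) * ennreal (\<Sum>y\<in>(\<Union>x\<in>D. gball \<mu> x (r x)). ?g y)"
    using \<open>C > 0\<close> \<open>l > 0\<close> f(1) by (intro ennreal_mult sum_nonneg) auto
  also have "\<dots> \<le> ennreal (2 * C / l) * (\<integral>\<^sup>+y. ennreal (?g y) \<partial>count_space UNIV)"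
    using finD f(1) by (intro mult_left_mono finite_sum_le_nn_integral_count_space) auto
  finally show ?thesis .
qed

text \<open>Layer-cake over the levels 2^k with the truncated weak-type bound: after exchanging
  sums, each y keeps a dyadic sum restricted to 2^k < 2 f y, which is of order (f y)^(P -
  1).\<close>

lemma maximal_function_strong_type:
  assumes doubling: "\<And>x r. r > 0 \<Longrightarrow> volume \<mu> (gball \<mu> x (2 * r)) \<le> C * volume \<mu> (gball \<mu> x r)"
    and "C > 0" and "P > 1"
  obtains A where "A > 0"
    "\<And>f. (\<And>y. f y \<ge> 0) \<Longrightarrow> moment \<mu> P f < \<infinity> \<Longrightarrow>
       moment \<mu> P (maximal_function \<mu> f) \<le> ennreal A * moment \<mu> P f"
proof -
  obtain K where K: "K > 0"
    "\<And>y. y \<ge> 0 \<Longrightarrow> (\<integral>\<^sup>+k. ennreal (2 powr (real_of_int k * (P - 1)) * min 1 ((y / 2 powr real_of_int k) powr P))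
              \<partial>count_space UNIV) \<le> ennreal (K * y powr (P - 1))"
    using dyadic_sum_bound [of "P - 1" P] \<open>P > 1\<close> by auto
  \<comment> \<open>The layer between 2^k and 2^(k+1) contributes 2^((k+1) P), the weak-type bound 2
    C / 2^k; the product is c 2^(k (P - 1)).\<close>
  define c where "c = 2 powr (P + 1) * C"
  have c: "c > 0" using \<open>C > 0\<close> by (simp add: c_def)
  show ?thesis
  proof (rule that)
    show "c * K * 2 powr (P - 1) > 0" using c K by simp
    fix f :: "'a \<Rightarrow> real" assume f: "\<And>y. f y \<ge> 0" "moment \<mu> P f < \<infinity>"
    let ?M = "maximal_function \<mu> f"
    have M0: "?M x \<ge> 0" for x
      using le_maximal_function [OF f(1) _ f(2), of x] f(1) [of x] \<open>P > 1\<close> by linarith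
    let ?h = "\<lambda>k y. ennreal (of_bool (f y > 2 powr real_of_int k / 2) * f y * vweight \<mu> y)"
    have "moment \<mu> P ?M \<le> (\<integral>\<^sup>+k. \<integral>\<^sup>+y. ennreal (c * 2 powr (real_of_int k * (P - 1))) * ?h k y
        \<partial>count_space UNIV \<partial>count_space (UNIV :: int set))"
      unfolding moment_def
    proof (rule nn_integral_count_space_le_finite_sums)
      fix E :: "'a set" assume E: "finite E"
      let ?E = "\<lambda>k::int. {x\<in>E. 2 powr real_of_int k < ?M x}"
      let ?u = "\<lambda>k x. 2 powr (real_of_int (k + 1) * P) * of_bool (2 powr real_of_int k < ?M x) * vweight \<mu> x"
      have pt: "ennreal (\<bar>?M x\<bar> powr P * vweight \<mu> x) \<le> (\<integral>\<^sup>+k. ennreal (?u k x) \<partial>count_space UNIV)" for x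
      proof (cases "?M x = 0")
        case False
        then have "?M x > 0" using M0 [of x] by simp
        then obtain j :: int where j: "2 powr real_of_int (j - 1) < ?M x" "?M x \<le> 2 powr real_of_int j"
          by (rule dyadic_exponent_exists)
        have "?M x powr P \<le> (2 powr real_of_int j) powr P"
          using j M0 [of x] \<open>P > 1\<close> by (intro powr_mono2) auto
        then have "\<bar>?M x\<bar> powr P * vweight \<mu> x \<le> (\<Sum>k\<in>{j - 1}. ?u k x)"
          using j(1) M0 [of x] by (simp add: powr_powr mult_right_mono)
        then have "ennreal (\<bar>?M x\<bar> powr P * vweight \<mu> x) \<le> ennreal (\<Sum>k\<in>{j - 1}. ?u k x)"
          by (rule ennreal_leI)
        also have "\<dots> \<le> (\<integral>\<^sup>+k. ennreal (?u k x) \<partial>count_space UNIV)"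
          by (rule finite_sum_le_nn_integral_count_space) auto
        finally show ?thesis .
      qed simp
      have "ennreal (\<Sum>x\<in>E. \<bar>?M x\<bar> powr P * vweight \<mu> x) = (\<Sum>x\<in>E. ennreal (\<bar>?M x\<bar> powr P * vweight \<mu> x))"
        by (simp add: sum_ennreal)
      also have "\<dots> \<le> (\<Sum>x\<in>E. \<integral>\<^sup>+k. ennreal (?u k x) \<partial>count_space UNIV)"
        by (intro sum_mono pt)
      also have "\<dots> = (\<integral>\<^sup>+k. (\<Sum>x\<in>E. ennreal (?u k x)) \<partial>count_space UNIV)"
        by (rule nn_integral_sum [symmetric]) simp
      also have "\<dots> = (\<integral>\<^sup>+k. ennreal (2 powr (real_of_int (k + 1) * P)) * ennreal (volume \<mu> (?E k)) \<partial>count_space UNIV)"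
      proof (rule nn_integral_cong)
        fix k :: int
        have "(\<Sum>x\<in>E. ?u k x) = 2 powr (real_of_int (k + 1) * P) * volume \<mu> (?E k)"
          using E by (auto simp: volume_def sum_distrib_left sum.inter_filter intro!: sum.cong)
        then show "(\<Sum>x\<in>E. ennreal (?u k x)) =
            ennreal (2 powr (real_of_int (k + 1) * P)) * ennreal (volume \<mu> (?E k))"
          by (simp add: sum_ennreal ennreal_mult [symmetric] volume_def sum_nonneg)
      qed
      also have "\<dots> \<le> (\<integral>\<^sup>+k. ennreal (2 powr (real_of_int (k + 1) * P)) *
          (ennreal (2 * C / 2 powr real_of_int k) * (\<integral>\<^sup>+y. ?h k y \<partial>count_space UNIV)) \<partial>count_space UNIV)"
        using \<open>P > 1\<close> E
        by (intro nn_integral_mono mult_left_mono maximal_function_weak_type [OF doubling \<open>C > 0\<close> f(1) _ f(2)]) auto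
      also have "\<dots> = (\<integral>\<^sup>+k. \<integral>\<^sup>+y. ennreal (c * 2 powr (real_of_int k * (P - 1))) * ?h k y
        \<partial>count_space UNIV \<partial>count_space (UNIV :: int set))"
      proof (rule nn_integral_cong)
        fix k :: int
        have "2 powr (real_of_int (k + 1) * P) * (2 * C / 2 powr real_of_int k) = c * 2 powr (real_of_int k * (P - 1))"
          by (simp add: c_def powr_add powr_diff algebra_simps)
        then have "ennreal (2 powr (real_of_int (k + 1) * P)) * ennreal (2 * C / 2 powr real_of_int k)
            = ennreal (c * 2 powr (real_of_int k * (P - 1)))"
          by (simp flip: ennreal_mult')
        then show "ennreal (2 powr (real_of_int (k + 1) * P)) *
          (ennreal (2 * C / 2 powr real_of_int k) * (\<integral>\<^sup>+y. ?h k y \<partial>count_space UNIV)) =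
            (\<integral>\<^sup>+y. ennreal (c * 2 powr (real_of_int k * (P - 1))) * ?h k y \<partial>count_space UNIV)"
          by (subst nn_integral_cmult) (auto simp: mult.assoc [symmetric])
      qed
      finally show "ennreal (\<Sum>x\<in>E. \<bar>?M x\<bar> powr P * vweight \<mu> x) \<le> \<dots>" .
    qed auto
    also have "\<dots> = (\<integral>\<^sup>+y. \<integral>\<^sup>+k. ennreal (c * 2 powr (real_of_int k * (P - 1))) * ?h k y
        \<partial>count_space (UNIV :: int set) \<partial>count_space UNIV)"
      by (rule nn_integral_count_space_nn_integral [symmetric]) auto
    also have "\<dots> \<le> (\<integral>\<^sup>+y. ennreal (c * K * 2 powr (P - 1)) * ennreal (\<bar>f y\<bar> powr P * vweight \<mu> y) \<partial>count_space UNIV)"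
    proof (rule nn_integral_mono)
      fix y
      have "(\<integral>\<^sup>+k. ennreal (c * 2 powr (real_of_int k * (P - 1))) * ?h k y \<partial>count_space (UNIV :: int set))
         \<le> (\<integral>\<^sup>+k. ennreal (c * f y * vweight \<mu> y) *
            ennreal (2 powr (real_of_int k * (P - 1)) * min 1 ((2 * f y / 2 powr real_of_int k) powr P))
            \<partial>count_space UNIV)"
      proof (rule nn_integral_mono)
        fix k :: int
        \<comment> \<open>The indicator is relaxed to the weight for which the dyadic sum is known,
          at the point 2 f y.\<close>
        have "of_bool (f y > 2 powr real_of_int k / 2) \<le> min 1 ((2 * f y / 2 powr real_of_int k) powr P)"
        proof (cases "f y > 2 powr real_of_int k / 2")
          case True
          then have "1 \<le> 2 * f y / 2 powr real_of_int k" by (simp add: field_simps)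
          then have "1 \<le> (2 * f y / 2 powr real_of_int k) powr P"
            using \<open>P > 1\<close> by (intro ge_one_powr_ge_zero) auto
          then show ?thesis using True by simp
        qed simp
        then have "c * f y * vweight \<mu> y * 2 powr (real_of_int k * (P - 1)) * of_bool (f y > 2 powr real_of_int k / 2)
            \<le> c * f y * vweight \<mu> y * 2 powr (real_of_int k * (P - 1)) * min 1 ((2 * f y / 2 powr real_of_int k) powr P)"
          using c f(1) by (intro mult_left_mono) auto
        then have "ennreal (c * 2 powr (real_of_int k * (P - 1)) * (of_bool (f y > 2 powr real_of_int k / 2) * f y * vweight \<mu> y))
          \<le> ennreal (c * f y * vweight \<mu> y * (2 powr (real_of_int k * (P - 1)) * min 1 ((2 * f y / 2 powr real_of_int k) powr P)))"
          by (intro ennreal_leI) (simp add: mult_ac)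
        then show "ennreal (c * 2 powr (real_of_int k * (P - 1))) * ?h k y
          \<le> ennreal (c * f y * vweight \<mu> y) *
            ennreal (2 powr (real_of_int k * (P - 1)) * min 1 ((2 * f y / 2 powr real_of_int k) powr P))"
          using c f(1) by (subst (1 2) ennreal_mult [symmetric]) auto
      qed
      also have "\<dots> \<le> ennreal (c * f y * vweight \<mu> y) * ennreal (K * (2 * f y) powr (P - 1))"
        using K(2) [of "2 * f y"] f(1) by (subst nn_integral_cmult) (auto intro!: mult_left_mono)
      also have "\<dots> = ennreal (c * f y * vweight \<mu> y * (K * (2 * f y) powr (P - 1)))"
        using c f(1) K(1) by (subst ennreal_mult) auto
      also have "c * f y * vweight \<mu> y * (K * (2 * f y) powr (P - 1))
          = c * K * 2 powr (P - 1) * (\<bar>f y\<bar> powr P * vweight \<mu> y)"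
        using f(1) [of y] by (simp add: powr_mult powr_diff)
      also have "ennreal \<dots> = ennreal (c * K * 2 powr (P - 1)) * ennreal (\<bar>f y\<bar> powr P * vweight \<mu> y)"
        using c K(1) by (subst ennreal_mult) auto
      finally show "(\<integral>\<^sup>+k. ennreal (c * 2 powr (real_of_int k * (P - 1))) * ?h k y \<partial>count_space (UNIV :: int set))
        \<le> ennreal (c * K * 2 powr (P - 1)) * ennreal (\<bar>f y\<bar> powr P * vweight \<mu> y)" .
    qed
    also have "\<dots> = ennreal (c * K * 2 powr (P - 1)) * moment \<mu> P f"
      unfolding moment_def by (rule nn_integral_cmult) simp
    finally show "moment \<mu> P ?M \<le> ennreal (c * K * 2 powr (P - 1)) * moment \<mu> P f" .
  qed
qed

end

section \<open>Lipschitz truncation\<close>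

context weighted_graph
begin

lemma mean_gball: "mean \<mu> (gball \<mu> x r) f = average \<mu> f x r"
  by (simp add: mean_def average_def)

text \<open>Jensen's inequality up to a factor 2, from t \<le> A + A^(1-s) t^s: for t > A the last
  term is t (t/A)^(s-1) and already exceeds t.\<close>

lemma average_abs_le_of_average_powr_le:
  assumes "r > 0" "s \<ge> 1" "A > 0"
    and le: "(\<Sum>y\<in>gball \<mu> x r. \<bar>u y\<bar> powr s * vweight \<mu> y) \<le> A powr s * volume \<mu> (gball \<mu> x r)"
  shows "(\<Sum>y\<in>gball \<mu> x r. \<bar>u y\<bar> * vweight \<mu> y) \<le> 2 * A * volume \<mu> (gball \<mu> x r)"
proof -
  let ?B = "gball \<mu> x r"
  have pt: "t \<le> A + A powr (1 - s) * t powr s" if "t \<ge> 0" for t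
  proof (cases "t \<le> A")
    case False
    then have "1 \<le> (t / A) powr (s - 1)"
      using \<open>A > 0\<close> \<open>s \<ge> 1\<close> by (intro ge_one_powr_ge_zero) auto
    from mult_left_mono [OF this that]
    have "t \<le> A powr (1 - s) * t powr s"
      using \<open>A > 0\<close> False that by (simp add: powr_divide powr_diff field_simps)
    then show ?thesis using \<open>A > 0\<close> by simp
  qed (use \<open>A > 0\<close> in \<open>simp add: add_increasing2\<close>)
  have "(\<Sum>y\<in>?B. \<bar>u y\<bar> * vweight \<mu> y) \<le> (\<Sum>y\<in>?B. (A + A powr (1 - s) * \<bar>u y\<bar> powr s) * vweight \<mu> y)"
    using pt by (intro sum_mono mult_right_mono) auto
  also have "\<dots> = A * volume \<mu> ?B + A powr (1 - s) * (\<Sum>y\<in>?B. \<bar>u y\<bar> powr s * vweight \<mu> y)"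
    by (simp add: distrib_right sum.distrib volume_def sum_distrib_left mult.assoc)
  also have "\<dots> \<le> A * volume \<mu> ?B + A powr (1 - s) * (A powr s * volume \<mu> ?B)"
    using le by (intro add_left_mono mult_left_mono) auto
  also have "\<dots> = 2 * A * volume \<mu> ?B"
    using \<open>A > 0\<close> by (simp add: mult.assoc [symmetric] powr_add [symmetric])
  finally show ?thesis .
qed

text \<open>Passing to a sub-ball of comparable volume enlarges the mean oscillation about c by at
  most the volume ratio. It is applied with D = C to concentric balls and with D = C * C to balls
  about two different points.\<close>

lemma average_diff_le:
  assumes sub: "gball \<mu> y \<rho> \<subseteq> gball \<mu> x r" and "\<rho> \<ge> 0"
    and vol: "volume \<mu> (gball \<mu> x r) \<le> D * volume \<mu> (gball \<mu> y \<rho>)"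
    and osc: "(\<Sum>z\<in>gball \<mu> x r. \<bar>f z - c\<bar> * vweight \<mu> z) \<le> M * volume \<mu> (gball \<mu> x r)" and "M \<ge> 0"
  shows "\<bar>average \<mu> f y \<rho> - c\<bar> \<le> D * M"
proof -
  let ?V = "volume \<mu> (gball \<mu> y \<rho>)"
  have V: "?V > 0" using volume_pos \<open>\<rho> \<ge> 0\<close> by blast
  have "average \<mu> f y \<rho> - c = (\<Sum>z\<in>gball \<mu> y \<rho>. (f z - c) * vweight \<mu> z) / ?V"
    using V by (simp add: average_def left_diff_distrib sum_subtractf sum_distrib_left [symmetric]
        volume_def field_simps)
  then have "\<bar>average \<mu> f y \<rho> - c\<bar> = \<bar>\<Sum>z\<in>gball \<mu> y \<rho>. (f z - c) * vweight \<mu> z\<bar> / ?V"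
    using V by simp
  also have "\<dots> \<le> (\<Sum>z\<in>gball \<mu> y \<rho>. \<bar>(f z - c) * vweight \<mu> z\<bar>) / ?V"
    using V by (intro divide_right_mono sum_abs) auto
  also have "\<dots> \<le> (\<Sum>z\<in>gball \<mu> x r. \<bar>f z - c\<bar> * vweight \<mu> z) / ?V"
    using V sub by (intro divide_right_mono) (auto simp: abs_mult intro!: sum_mono2)
  also have "\<dots> \<le> M * (D * ?V) / ?V"
    using V osc vol \<open>M \<ge> 0\<close> by (intro divide_right_mono order_trans [OF osc] mult_left_mono) auto
  also have "\<dots> = D * M" using V by simp
  finally show ?thesis .
qed

lemma lipschitz_on_good_set:
  assumes doubling: "\<And>x r. r > 0 \<Longrightarrow> volume \<mu> (gball \<mu> x (2 * r)) \<le> C * volume \<mu> (gball \<mu> x r)"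
    and "C > 0" and "s \<ge> 1" and "poincare \<mu> s"
  obtains L where "L > 0" "\<And>f l x y. l > 0 \<Longrightarrow>
      (\<And>r. r > 0 \<Longrightarrow> average \<mu> (\<lambda>z. grad \<mu> f z powr s) x r \<le> l powr s) \<Longrightarrow>
      (\<And>r. r > 0 \<Longrightarrow> average \<mu> (\<lambda>z. grad \<mu> f z powr s) y r \<le> l powr s) \<Longrightarrow>
      \<bar>f x - f y\<bar> \<le> L * l * real (gdist \<mu> x y)"
proof -
  obtain Cp where Cp: "Cp > 0" "\<And>x r f. r > 0 \<Longrightarrow>
        (\<Sum>y\<in>gball \<mu> x r. \<bar>f y - mean \<mu> (gball \<mu> x r) f\<bar> powr s * vweight \<mu> y)
          \<le> Cp * r powr s * (\<Sum>y\<in>gball \<mu> x r. \<bar>grad \<mu> f y\<bar> powr s * vweight \<mu> y)"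
    using \<open>poincare \<mu> s\<close> unfolding poincare_def by blast
  \<comment> \<open>The s-th root of the Poincare constant, doubled by the passage from s-th powers
    to first powers.\<close>
  define K where "K = 2 * Cp powr (1 / s)"
  have K: "K > 0" using Cp by (simp add: K_def)
  show ?thesis
  proof (rule that)
    \<comment> \<open>Telescoping at x from radius 2 r costs 4 C K, at y from radius r costs 2 C K,
      and comparing the two averages costs 2 C C K.\<close>
    show "6 * C * K + 2 * C * C * K > 0" using K \<open>C > 0\<close> by (simp add: add_pos_pos)
    fix f :: "'a \<Rightarrow> real" and l :: real and x y
    assume l: "l > 0"
    define good where "good z \<longleftrightarrow> (\<forall>r>0. average \<mu> (\<lambda>z. grad \<mu> f z powr s) z r \<le> l powr s)" for z
    have osc: "(\<Sum>z\<in>gball \<mu> x r. \<bar>f z - average \<mu> f x r\<bar> * vweight \<mu> z)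
        \<le> (K * r * l) * volume \<mu> (gball \<mu> x r)" if "good x" "r > 0" for x r
    proof -
      have V: "volume \<mu> (gball \<mu> x r) > 0" using volume_pos \<open>r > 0\<close> by simp
      have "average \<mu> (\<lambda>z. grad \<mu> f z powr s) x r \<le> l powr s"
        using that by (simp add: good_def)
      then have *: "(\<Sum>y\<in>gball \<mu> x r. grad \<mu> f y powr s * vweight \<mu> y) \<le> l powr s * volume \<mu> (gball \<mu> x r)"
        using V by (simp add: average_def field_simps)
      have "(\<Sum>y\<in>gball \<mu> x r. \<bar>f y - average \<mu> f x r\<bar> powr s * vweight \<mu> y)
          \<le> Cp * r powr s * (\<Sum>y\<in>gball \<mu> x r. grad \<mu> f y powr s * vweight \<mu> y)"
        using Cp(2) [OF \<open>r > 0\<close>, of f x] by (simp add: mean_gball)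
      also have "\<dots> \<le> Cp * r powr s * (l powr s * volume \<mu> (gball \<mu> x r))"
        using Cp(1) * by (intro mult_left_mono) auto
      also have "\<dots> = (Cp powr (1 / s) * r * l) powr s * volume \<mu> (gball \<mu> x r)"
        using Cp(1) \<open>r > 0\<close> l \<open>s \<ge> 1\<close> by (simp add: powr_mult powr_powr)
      finally show ?thesis
        using average_abs_le_of_average_powr_le [of r s "Cp powr (1 / s) * r * l" "\<lambda>y. f y - average \<mu> f x r" x]
          Cp(1) l \<open>r > 0\<close> \<open>s \<ge> 1\<close> by (simp add: K_def mult.assoc)
    qed
    \<comment> \<open>The bound reproduces itself under halving: C K r l for the radius r / 2 plus C
      K r l for one step. The chain ends exactly, since below radius 1 the average is f x, so no
      limit is taken.\<close>
    have tele: "\<bar>f x - average \<mu> f x r\<bar> \<le> 2 * C * K * r * l" if good: "good x" and "r > 0" for x r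
    proof -
      have "0 < r \<Longrightarrow> r < 2 ^ n \<Longrightarrow> \<bar>f x - average \<mu> f x r\<bar> \<le> 2 * C * K * r * l" for n
      proof (induction n arbitrary: r)
        case 0
        then have "average \<mu> f x r = f x"
          using vweight_pos [of x] by (simp add: average_def gball_lt_1 volume_def)
        then show ?case using 0 K \<open>C > 0\<close> l by simp
      next
        case (Suc n)
        have "\<bar>f x - average \<mu> f x (r / 2)\<bar> \<le> 2 * C * K * (r / 2) * l"
          using Suc.prems by (intro Suc.IH) auto
        moreover have "\<bar>average \<mu> f x (r / 2) - average \<mu> f x r\<bar> \<le> C * (K * r * l)"
        proof (rule average_diff_le)
          show "gball \<mu> x (r / 2) \<subseteq> gball \<mu> x r"
            using Suc.prems by (intro gball_subset) auto
          show "volume \<mu> (gball \<mu> x r) \<le> C * volume \<mu> (gball \<mu> x (r / 2))"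
            using doubling [of "r / 2" x] Suc.prems by simp
          show "(\<Sum>z\<in>gball \<mu> x r. \<bar>f z - average \<mu> f x r\<bar> * vweight \<mu> z)
            \<le> K * r * l * volume \<mu> (gball \<mu> x r)"
            using osc good Suc.prems by blast
        qed (use Suc.prems K l in auto)
        ultimately show ?case by (simp add: mult.assoc)
      qed
      moreover obtain n where "r < 2 ^ n" using real_arch_pow [of 2 r] by auto
      ultimately show ?thesis using that by blast
    qed
    assume "\<And>r. r > 0 \<Longrightarrow> average \<mu> (\<lambda>z. grad \<mu> f z powr s) x r \<le> l powr s"
      and "\<And>r. r > 0 \<Longrightarrow> average \<mu> (\<lambda>z. grad \<mu> f z powr s) y r \<le> l powr s"
    then have good: "good x" "good y" by (auto simp: good_def)
    show "\<bar>f x - f y\<bar> \<le> (6 * C * K + 2 * C * C * K) * l * real (gdist \<mu> x y)"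
    proof (cases "x = y")
      case False
      define r where "r = real (gdist \<mu> x y)"
      have r: "r > 0" using False gdist_eq_0_iff [of x y] unfolding r_def by linarith
      have 1: "\<bar>f x - average \<mu> f x (2 * r)\<bar> \<le> 2 * C * K * (2 * r) * l"
        using good r by (intro tele) auto
      have 2: "\<bar>f y - average \<mu> f y r\<bar> \<le> 2 * C * K * r * l"
        using good r by (intro tele) auto
      have 3: "\<bar>average \<mu> f y r - average \<mu> f x (2 * r)\<bar> \<le> (C * C) * (K * (2 * r) * l)"
      proof (rule average_diff_le)
        show "gball \<mu> y r \<subseteq> gball \<mu> x (2 * r)"
          by (intro gball_subset) (simp add: r_def)
        \<comment> \<open>The reverse inclusion needs radius 3 r about y; rounding up to 4 r makes
          it two doublings.\<close>
        have "volume \<mu> (gball \<mu> x (2 * r)) \<le> volume \<mu> (gball \<mu> y (2 * (2 * r)))"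
          using r gdist_commute [of x y] by (intro volume_mono gball_subset) (auto simp: r_def)
        also have "\<dots> \<le> C * volume \<mu> (gball \<mu> y (2 * r))"
          using r by (intro doubling) auto
        also have "\<dots> \<le> C * (C * volume \<mu> (gball \<mu> y r))"
          using r \<open>C > 0\<close> by (intro doubling mult_left_mono) auto
        finally show "volume \<mu> (gball \<mu> x (2 * r)) \<le> C * C * volume \<mu> (gball \<mu> y r)"
          by (simp add: mult.assoc)
        show "(\<Sum>z\<in>gball \<mu> x (2 * r). \<bar>f z - average \<mu> f x (2 * r)\<bar> * vweight \<mu> z)
            \<le> K * (2 * r) * l * volume \<mu> (gball \<mu> x (2 * r))"
          using osc good r by simp
      qed (use r K l in auto)
      have "\<bar>f x - f y\<bar> \<le> 2 * C * K * (2 * r) * l + 2 * C * K * r * l + C * C * (K * (2 * r) * l)"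
        using 1 2 3 by linarith
      also have "\<dots> = (6 * C * K + 2 * C * C * K) * l * r"
        by (simp add: algebra_simps)
      finally show ?thesis by (simp add: r_def)
    qed simp
  qed
qed

text \<open>Under \<open>Delta_cond\<close> an edge carries at least the fraction \<alpha> of the
  mass of either endpoint, and the edge weights at y add up to the mass of y.\<close>

lemma Delta_cond_sum_neighbours_le:
  assumes "Delta_cond \<mu> \<alpha>" "\<alpha> > 0"
  shows "(\<Sum>x | adj \<mu> y x. vweight \<mu> x) \<le> vweight \<mu> y / \<alpha>"
proof -
  have "vweight \<mu> x \<le> \<mu> y x / \<alpha>" if "adj \<mu> y x" for x
    using assms that adj_sym [of y x] weight_sym [of x y]
    by (auto simp: Delta_cond_def field_simps)
  then have "(\<Sum>x | adj \<mu> y x. vweight \<mu> x) \<le> (\<Sum>x | adj \<mu> y x. \<mu> y x / \<alpha>)"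
    by (intro sum_mono) auto
  also have "\<dots> = vweight \<mu> y / \<alpha>"
    by (simp add: vweight_eq sum_divide_distrib)
  finally show ?thesis .
qed

text \<open>The maximum is dominated by the sum over the neighbours; after exchanging sums each y is
  weighted by the total mass of its neighbours.\<close>

lemma moment_Max_neighbours_le:
  assumes "Delta_cond \<mu> \<alpha>" "\<alpha> > 0" "\<And>x. f x \<ge> 0" "P \<ge> 0"
  shows "moment \<mu> P (\<lambda>x. Max (f ` {y. adj \<mu> x y})) \<le> ennreal (1 / \<alpha>) * moment \<mu> P f"
  unfolding moment_def
proof (rule nn_integral_count_space_le_finite_sums)
  fix E :: "'a set" assume E: "finite E"
  let ?U = "\<Union>x\<in>E. {y. adj \<mu> x y}"
  have pt: "\<bar>Max (f ` {y. adj \<mu> x y})\<bar> powr P \<le> (\<Sum>y | adj \<mu> x y. f y powr P)" for x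
  proof -
    have "{y. adj \<mu> x y} \<noteq> {}" using assms(1) by (auto simp: Delta_cond_def)
    then have "Max (f ` {y. adj \<mu> x y}) \<in> f ` {y. adj \<mu> x y}"
      by (intro Max_in) auto
    then obtain y where y: "adj \<mu> x y" "Max (f ` {y. adj \<mu> x y}) = f y" by auto
    have "f y powr P \<le> (\<Sum>y | adj \<mu> x y. f y powr P)"
      using y(1) by (intro member_le_sum) auto
    then show ?thesis using y assms(3) by simp
  qed
  have "(\<Sum>x\<in>E. \<bar>Max (f ` {y. adj \<mu> x y})\<bar> powr P * vweight \<mu> x)
      \<le> (\<Sum>x\<in>E. \<Sum>y | adj \<mu> x y. f y powr P * vweight \<mu> x)"
    using pt by (auto simp: sum_distrib_right [symmetric] intro!: sum_mono mult_right_mono)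
  also have "\<dots> = (\<Sum>x\<in>E. \<Sum>y | y \<in> ?U \<and> adj \<mu> x y. f y powr P * vweight \<mu> x)"
    by (intro sum.cong) auto
  also have "\<dots> = (\<Sum>y\<in>?U. \<Sum>x | x \<in> E \<and> adj \<mu> x y. f y powr P * vweight \<mu> x)"
    using E by (intro sum.swap_restrict) auto
  also have "\<dots> \<le> (\<Sum>y\<in>?U. \<Sum>x | adj \<mu> y x. f y powr P * vweight \<mu> x)"
    by (intro sum_mono sum_mono2) (auto simp: adj_sym)
  also have "\<dots> \<le> (\<Sum>y\<in>?U. 1 / \<alpha> * (f y powr P * vweight \<mu> y))"
    using mult_left_mono [OF Delta_cond_sum_neighbours_le [OF assms(1,2)], of "f _ powr P"]
    by (intro sum_mono) (simp add: sum_distrib_left [symmetric])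
  also have "\<dots> = 1 / \<alpha> * (\<Sum>y\<in>?U. \<bar>f y\<bar> powr P * vweight \<mu> y)"
    using assms(3) by (simp add: sum_distrib_left)
  finally have "ennreal (\<Sum>x\<in>E. \<bar>Max (f ` {y. adj \<mu> x y})\<bar> powr P * vweight \<mu> x)
      \<le> ennreal (1 / \<alpha> * (\<Sum>y\<in>?U. \<bar>f y\<bar> powr P * vweight \<mu> y))"
    by (rule ennreal_leI)
  also have "\<dots> = ennreal (1 / \<alpha>) * ennreal (\<Sum>y\<in>?U. \<bar>f y\<bar> powr P * vweight \<mu> y)"
    using assms(2) by (intro ennreal_mult sum_nonneg) auto
  also have "\<dots> \<le> ennreal (1 / \<alpha>) * (\<integral>\<^sup>+x. ennreal (\<bar>f x\<bar> powr P * vweight \<mu> x) \<partial>count_space UNIV)"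
    using E by (intro mult_left_mono finite_sum_le_nn_integral_count_space) auto
  finally show "ennreal (\<Sum>x\<in>E. \<bar>Max (f ` {y. adj \<mu> x y})\<bar> powr P * vweight \<mu> x) \<le> \<dots>" .
qed auto

text \<open>\<open>h\<close> is chosen before the level l, so one function measures the truncations
  at all levels at once; this is what allows summation over dyadic levels later.\<close>

lemma lipschitz_truncation:
  assumes "doubling \<mu>" "Delta_cond \<mu> \<alpha>" "\<alpha> > 0" "poincare \<mu> s" "1 \<le> s" "s < p"
  obtains A where "A > 0" "\<And>f. moment \<mu> p (grad \<mu> f) < \<infinity> \<Longrightarrow>
    \<exists>h. (\<forall>x. h x \<ge> 0) \<and> moment \<mu> p h \<le> ennreal A * moment \<mu> p (grad \<mu> f) \<and>
      (\<forall>l>0. \<exists>b g. (\<forall>x. f x = b x + g x) \<and> (\<forall>x. grad \<mu> b x \<le> A * (of_bool (h x > l) * h x)) \<and>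
        (\<forall>x. grad \<mu> g x \<le> A * min (h x) l))"
proof -
  obtain C where C: "C > 0" "\<And>x r. r > 0 \<Longrightarrow> volume \<mu> (gball \<mu> x (2 * r)) \<le> C * volume \<mu> (gball \<mu> x r)"
    using \<open>doubling \<mu>\<close> unfolding doubling_def by blast
  define P where "P = p / s"
  have P: "P > 1" using assms by (simp add: P_def)
  obtain L where L: "L > 0" "\<And>f l x y. l > 0 \<Longrightarrow>
      (\<And>r. r > 0 \<Longrightarrow> average \<mu> (\<lambda>z. grad \<mu> f z powr s) x r \<le> l powr s) \<Longrightarrow>
      (\<And>r. r > 0 \<Longrightarrow> average \<mu> (\<lambda>z. grad \<mu> f z powr s) y r \<le> l powr s) \<Longrightarrow>
      \<bar>f x - f y\<bar> \<le> L * l * real (gdist \<mu> x y)"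
    using lipschitz_on_good_set [OF C(2,1) \<open>1 \<le> s\<close> \<open>poincare \<mu> s\<close>] by blast
  obtain A0 where A0: "A0 > 0" "\<And>f. (\<And>y. f y \<ge> 0) \<Longrightarrow> moment \<mu> P f < \<infinity> \<Longrightarrow>
       moment \<mu> P (maximal_function \<mu> f) \<le> ennreal A0 * moment \<mu> P f"
    using maximal_function_strong_type [OF C(2,1) P] by blast
  \<comment> \<open>A0 / \<alpha> bounds the moment of h, 2 * (1 + L) the gradient of f - g where h
    > l; the latter also exceeds L and 1, as needed for g.\<close>
  define A where "A = max (A0 / \<alpha>) (2 * (1 + L))"
  have A: "A0 / \<alpha> \<le> A" "2 * (1 + L) \<le> A" "1 \<le> A" "L \<le> A" using L(1) by (auto simp: A_def)
  show ?thesis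
  proof (rule that)
    show "A > 0" using A by simp
    fix f :: "'a \<Rightarrow> real" assume fin: "moment \<mu> p (grad \<mu> f) < \<infinity>"
    define G where "G z = grad \<mu> f z powr s" for z
    have G_eq: "G = (\<lambda>z. grad \<mu> f z powr s)" by (simp add: G_def fun_eq_iff)
    have G0: "G z \<ge> 0" for z by (simp add: G_def)
    have momG: "moment \<mu> P G = moment \<mu> p (grad \<mu> f)"
      using assms by (simp add: moment_def G_def P_def powr_powr)
    then have finG: "moment \<mu> P G < \<infinity>" using fin by simp
    note le_max = le_maximal_function [OF G0 less_imp_le [OF P] finG]
      and avg_le_max = average_le_maximal_function [OF G0 less_imp_le [OF P] finG]
    let ?M = "maximal_function \<mu> G"
    have M0: "?M x \<ge> 0" for x using le_max [of x] G0 [of x] by linarith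
    define m where "m x = Max (?M ` {y. adj \<mu> x y})" for x
    have M_le: "?M y \<le> m x" if "adj \<mu> x y" for x y
      unfolding m_def using that by (intro Max_ge) auto
    \<comment> \<open>As x is its own neighbour, \<open>m x\<close> dominates the maximal function
      at x, and h x \<le> l also puts x itself into the good set.\<close>
    have adj_refl: "adj \<mu> x x" for x using assms(2) by (auto simp: Delta_cond_def)
    have m0: "m x \<ge> 0" for x using M_le [OF adj_refl] M0 [of x] by (rule order_trans [rotated])
    define h where "h x = m x powr (1 / s)" for x
    have h0: "h x \<ge> 0" for x by (simp add: h_def)
    have hs: "h x powr s = m x" for x using assms m0 [of x] by (simp add: h_def powr_powr)
    have grad_le_h: "grad \<mu> f x \<le> h x" for x
    proof -
      have "grad \<mu> f x powr s \<le> h x powr s"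
        unfolding hs using le_max [of x] M_le [OF adj_refl [of x]] by (simp add: G_def)
      then show ?thesis
        using powr_less_mono2 [of s "h x" "grad \<mu> f x"] h0 [of x] \<open>1 \<le> s\<close> by linarith
    qed
    show "\<exists>h. (\<forall>x. h x \<ge> 0) \<and> moment \<mu> p h \<le> ennreal A * moment \<mu> p (grad \<mu> f) \<and>
      (\<forall>l>0. \<exists>b g. (\<forall>x. f x = b x + g x) \<and> (\<forall>x. grad \<mu> b x \<le> A * (of_bool (h x > l) * h x)) \<and>
        (\<forall>x. grad \<mu> g x \<le> A * min (h x) l))"
    proof (rule exI [of _ h], intro conjI allI impI)
      show "h x \<ge> 0" for x by (rule h0)
      have "moment \<mu> p h = moment \<mu> P m"
        using m0 assms by (simp add: moment_def h_def P_def powr_powr)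
      also have "\<dots> \<le> ennreal (1 / \<alpha>) * moment \<mu> P ?M"
        unfolding m_def using assms M0 P by (intro moment_Max_neighbours_le) auto
      also have "\<dots> \<le> ennreal (1 / \<alpha>) * (ennreal A0 * moment \<mu> P G)"
        using A0(2) [OF G0 finG] by (rule mult_left_mono) simp
      also have "\<dots> = ennreal (A0 / \<alpha>) * moment \<mu> p (grad \<mu> f)"
        using A0(1) assms(3) by (simp add: momG mult.assoc [symmetric] ennreal_mult [symmetric])
      also have "\<dots> \<le> ennreal A * moment \<mu> p (grad \<mu> f)"
        using A by (intro mult_right_mono ennreal_leI) auto
      finally show "moment \<mu> p h \<le> ennreal A * moment \<mu> p (grad \<mu> f)" .
    next
      fix l :: real assume l: "l > 0"
      define E where "E = {x. ?M x \<le> l powr s}"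
      obtain g where g: "\<And>x. x \<in> E \<Longrightarrow> g x = f x" "\<And>x y. \<bar>g x - g y\<bar> \<le> L * l * real (gdist \<mu> x y)"
      proof (rule lipschitz_extension)
        have good: "average \<mu> (\<lambda>z. grad \<mu> f z powr s) x r \<le> l powr s" if "x \<in> E" "r > 0" for x r
          using order_trans [OF avg_le_max [OF that(2), of x]] that(1) by (simp add: E_def G_eq)
        fix x y assume "x \<in> E" "y \<in> E"
        then show "\<bar>f x - f y\<bar> \<le> L * l * real (gdist \<mu> x y)"
          by (intro L(2) l good)
      qed (use L l in auto)
      \<comment> \<open>Read contrapositively: if h x \<le> l, then f and g agree at x and all its
        neighbours, so the gradient at x cannot tell them apart.\<close>
      have bad: "h x > l" if "adj \<mu> x y" "y \<notin> E" for x y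
      proof -
        have "l powr s < h x powr s" unfolding hs using that M_le [OF that(1)] by (simp add: E_def)
        then show ?thesis using l h0 [of x] \<open>1 \<le> s\<close> powr_mono2 [of s "h x" l] by linarith
      qed
      have grad_g: "grad \<mu> g x \<le> L * l" for x
      proof (rule grad_le)
        fix y assume "adj \<mu> x y"
        then have "L * l * real (gdist \<mu> y x) \<le> L * l * 1"
          using gdist_adj_le [of x y] gdist_commute [of x y] L l by (intro mult_left_mono) auto
        then show "\<bar>g y - g x\<bar> \<le> L * l" using g(2) [of y x] by simp
      qed (use L l in auto)
      have eq: "g y = f y" if "adj \<mu> x y" "h x \<le> l" for x y
        using bad [OF that(1)] that(2) g(1) [of y] by (cases "y \<in> E") auto
      show "\<exists>b g. (\<forall>x. f x = b x + g x) \<and> (\<forall>x. grad \<mu> b x \<le> A * (of_bool (h x > l) * h x)) \<and>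
        (\<forall>x. grad \<mu> g x \<le> A * min (h x) l)"
      proof (rule exI [of _ "\<lambda>x. f x - g x"], rule exI [of _ g], intro conjI allI)
        fix x
        show "f x = f x - g x + g x" by simp
        show "grad \<mu> (\<lambda>x. f x - g x) x \<le> A * (of_bool (h x > l) * h x)"
        proof (cases "h x > l")
          case True
          have "grad \<mu> (\<lambda>x. f x - g x) x \<le> 2 * (h x + L * l)"
            using grad_diff_le [of f g x] grad_le_h [of x] grad_g [of x] by simp
          also have "\<dots> \<le> 2 * (h x + L * h x)" using True L by simp
          also have "\<dots> = 2 * (1 + L) * h x" by (simp add: algebra_simps)
          also have "\<dots> \<le> A * h x" using A h0 by (intro mult_right_mono) auto
          finally show ?thesis using True by simp
        next
          case False
          then have "grad \<mu> (\<lambda>x. f x - g x) x \<le> 0"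
            using eq [of x] adj_refl by (intro grad_le) auto
          then show ?thesis using False by simp
        qed
        show "grad \<mu> g x \<le> A * min (h x) l"
        proof (cases "h x > l")
          case True
          have "L * l \<le> A * l" using A l by simp
          then show ?thesis using grad_g [of x] True by simp
        next
          case False
          have "grad \<mu> g x = grad \<mu> f x"
            using False eq [of x] adj_refl by (intro grad_cong) auto
          moreover have "1 * h x \<le> A * h x" using A h0 by (intro mult_right_mono) auto
          ultimately show ?thesis using False grad_le_h [of x] by simp
        qed
      qed
    qed
  qed
qed

end

section \<open>The K-functional\<close>

text \<open>Nonnegativity on the carriers bounds the infimum in \<open>K_functional\<close> from
  below, so that it behaves as an infimum of affine functions of t with nonnegative
  coefficients.\<close>

locale interpolation_pair =
  fixes A0 A1 :: "'v::real_vector set" and N0 N1 :: "'v \<Rightarrow> real"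
  assumes N0_nonneg: "a \<in> A0 \<Longrightarrow> N0 a \<ge> 0" and N1_nonneg: "a \<in> A1 \<Longrightarrow> N1 a \<ge> 0"
begin

abbreviation K :: "'v \<Rightarrow> real \<Rightarrow> real" where
  "K \<equiv> K_functional A0 N0 A1 N1"

lemma K_le:
  assumes "a0 \<in> A0" "a1 \<in> A1" "t \<ge> 0"
  shows "K (a0 + a1) t \<le> N0 a0 + t * N1 a1"
  unfolding K_functional_def using assms N0_nonneg N1_nonneg
  by (intro cInf_lower bdd_belowI [of _ 0]) auto

lemma le_K:
  assumes "\<exists>a0\<in>A0. \<exists>a1\<in>A1. f = a0 + a1"
    and "\<And>a0 a1. a0 \<in> A0 \<Longrightarrow> a1 \<in> A1 \<Longrightarrow> f = a0 + a1 \<Longrightarrow> x \<le> N0 a0 + t * N1 a1"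
  shows "x \<le> K f t"
  unfolding K_functional_def using assms by (intro cInf_greatest) auto

lemma K_nonneg:
  assumes "\<exists>a0\<in>A0. \<exists>a1\<in>A1. f = a0 + a1" "t \<ge> 0"
  shows "K f t \<ge> 0"
  using assms N0_nonneg N1_nonneg by (intro le_K) auto

lemma K_mono:
  assumes "\<exists>a0\<in>A0. \<exists>a1\<in>A1. f = a0 + a1" "0 \<le> s" "s \<le> t"
  shows "K f s \<le> K f t"
proof (rule le_K)
  fix a0 a1 assume "a0 \<in> A0" "a1 \<in> A1" "f = a0 + a1"
  then show "K f s \<le> N0 a0 + t * N1 a1"
    using K_le [of a0 a1 s] assms mult_right_mono [of s t "N1 a1"] N1_nonneg by fastforce
qed fact

text \<open>For each decomposition N0 a0 / t + N1 a1 decreases in t, and the infimum inherits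
  this.\<close>

lemma K_div_antimono:
  assumes "\<exists>a0\<in>A0. \<exists>a1\<in>A1. f = a0 + a1" "0 < s" "s \<le> t"
  shows "K f t \<le> t / s * K f s"
proof -
  have "s / t * K f t \<le> K f s"
  proof (rule le_K)
    fix a0 a1 assume a: "a0 \<in> A0" "a1 \<in> A1" "f = a0 + a1"
    have "s / t * K f t \<le> s / t * (N0 a0 + t * N1 a1)"
      using K_le [of a0 a1 t] assms a by (intro mult_left_mono) auto
    also have "\<dots> = s / t * N0 a0 + s * N1 a1"
      using assms by (simp add: field_simps)
    also have "\<dots> \<le> 1 * N0 a0 + s * N1 a1"
      using assms N0_nonneg [OF a(1)] by (intro add_right_mono mult_right_mono) auto
    finally show "s / t * K f t \<le> N0 a0 + s * N1 a1" by simp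
  qed fact
  then show ?thesis using assms by (simp add: field_simps)
qed

text \<open>The infimum need not be attained, so a decomposition is obtained only for a bound
  strictly above it.\<close>

lemma K_lessD:
  assumes "\<exists>a0\<in>A0. \<exists>a1\<in>A1. f = a0 + a1" "K f t < k"
  obtains a0 a1 where "a0 \<in> A0" "a1 \<in> A1" "f = a0 + a1" "N0 a0 + t * N1 a1 < k"
  using le_K [OF assms(1), of k t] assms(2) by (meson not_le)

end

text \<open>A discrete intermediate value argument; the intervals are half-open and empty where u is
  constant.\<close>

lemma dyadic_bracket:
  fixes u :: "int \<Rightarrow> real"
  assumes "\<exists>k. u k < t" "\<exists>k. t \<le> u k" "\<And>j k. j \<le> k \<Longrightarrow> u k \<le> u j"
  obtains k where "u (k + 1) < t" "t \<le> u k"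
proof -
  obtain a b where ab: "t \<le> u a" "u b < t" using assms by blast
  then have "a \<le> b" using assms(3) [of b a] by (cases "a \<le> b") auto
  have "\<exists>k. u (k + 1) < t \<and> t \<le> u k"
  proof (rule ccontr)
    assume *: "\<not> ?thesis"
    have "t \<le> u k" if "a \<le> k" for k
      using that by (induction k rule: int_ge_induct) (use ab * in \<open>auto simp: not_less\<close>)
    then show False using ab \<open>a \<le> b\<close> by fastforce
  qed
  then show ?thesis using that by blast
qed

text \<open>The change of variable relating the parameter \<open>t\<close> of the K-functional to the truncation
  level \<open>2 ^ k\<close> is \<open>t = (l k / 2 ^ (k p1)) ^ \<delta>\<close>: it balances the two terms of the K-functional.\<close>

lemma K_integral_dyadic_bound:
  fixes K :: "real \<Rightarrow> real" and l :: "int \<Rightarrow> real" and p1 p \<theta> \<delta> c N :: real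
  defines "s \<equiv> \<lambda>k. (l k / 2 powr (real_of_int k * p1)) powr \<delta>"
  assumes K: "\<And>s t. 0 < s \<Longrightarrow> s \<le> t \<Longrightarrow> K s \<le> K t" "\<And>t. t > 0 \<Longrightarrow> K t \<ge> 0"
    and l: "\<And>k. l k > 0" "\<And>j k. j \<le> k \<Longrightarrow> l k \<le> l j" "\<And>k. l k \<le> 2 powr N * l (k + 1)"
    and Kl: "\<And>k. K (s k) \<le> c * l k powr (1 / p1)"
    and par: "1 \<le> p1" "p1 < p" "\<delta> > 0" "\<theta> \<ge> 0" "\<theta> * \<delta> = 1 / p1 - 1 / p" "c \<ge> 0"
  shows "(\<integral>\<^sup>+t\<in>{0<..}. ennreal ((t powr (- \<theta>) * K t) powr p / t) \<partial>lborel)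
     \<le> ennreal (c powr p * 2 powr ((N + p1) * \<delta> * (\<theta> * p + 1))) *
        (\<integral>\<^sup>+k. ennreal (l k * 2 powr (real_of_int k * (p - p1))) \<partial>count_space UNIV)"
proof -
  \<comment> \<open>Bounds the ratio of s k to s (k + 1): 2^N comes from l, 2^p1 from the
    denominator, and both are raised to the power \<delta>.\<close>
  define D where "D = 2 powr ((N + p1) * \<delta>)"
  have D: "D > 0" by (simp add: D_def)
  have spos: "s k > 0" for k using l(1) [of k] by (simp add: s_def)
  have s_anti: "s k \<le> s j" if "j \<le> k" for j k
    unfolding s_def using l that par
    by (intro powr_mono2 frac_le powr_mono mult_right_mono) (auto intro: less_imp_le)
  have s_D: "s k \<le> D * s (k + 1)" for k
  proof -
    have "s k \<le> (2 powr N * l (k + 1) / 2 powr (real_of_int k * p1)) powr \<delta>"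
      unfolding s_def using l par by (intro powr_mono2 divide_right_mono) (auto intro: less_imp_le)
    also have "2 powr N * l (k + 1) / 2 powr (real_of_int k * p1)
      = 2 powr (N + p1) * (l (k + 1) / 2 powr (real_of_int (k + 1) * p1))"
      by (simp add: powr_add algebra_simps)
    also have "\<dots> powr \<delta> = D * s (k + 1)"
      using l(1) [of "k + 1"] unfolding s_def D_def by (subst powr_mult) (auto simp: powr_powr less_imp_le)
    finally show ?thesis .
  qed
  have lim: "\<exists>j::int. 2 powr (- real_of_int j * (p1 * \<delta>)) < t" "\<exists>j::int. t \<le> 2 powr (- real_of_int j * (p1 * \<delta>))"
    if "t > 0" for t
  proof -
    have pd: "p1 * \<delta> > 0" using par by simp
    obtain j where j: "- log 2 t / (p1 * \<delta>) < real_of_int j" using ex_less_of_int by blast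
    then have "- real_of_int j * (p1 * \<delta>) < log 2 t" using pd by (simp add: field_simps)
    then show "\<exists>j::int. 2 powr (- real_of_int j * (p1 * \<delta>)) < t"
      using that by (auto simp: less_log_iff)
    obtain j where j: "real_of_int j < - log 2 t / (p1 * \<delta>)" using ex_of_int_less by blast
    then have "log 2 t \<le> - real_of_int j * (p1 * \<delta>)" using pd by (simp add: field_simps)
    then show "\<exists>j::int. t \<le> 2 powr (- real_of_int j * (p1 * \<delta>))"
      using that by (auto simp: log_le_iff)
  qed
  have s_split: "s k = l k powr \<delta> * 2 powr (- real_of_int k * (p1 * \<delta>))" for k
    using l(1) [of k] less_imp_neq [OF l(1) [of k]]
    by (simp add: s_def powr_divide powr_powr powr_minus field_simps less_imp_le)
  have l0: "l 0 powr \<delta> > 0" using less_imp_neq [OF l(1) [of 0]] by simp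
  \<comment> \<open>For k \<ge> 0 monotonicity gives l k \<le> l 0, so the power of 2 alone drives s
    k to 0; \<open>max j 0\<close> keeps k in that range. At the other end \<open>min j 0\<close>
    does the same with l k \<ge> l 0.\<close>
  have ex_less: "\<exists>k. s k < t" if t: "t > 0" for t
  proof -
    obtain j :: int where j: "2 powr (- real_of_int j * (p1 * \<delta>)) < t / l 0 powr \<delta>"
      using lim(1) [OF divide_pos_pos [OF t l0]] by blast
    define k where "k = max j 0"
    have "s k \<le> l 0 powr \<delta> * 2 powr (- real_of_int j * (p1 * \<delta>))"
      unfolding s_split using l par
      by (intro mult_mono powr_mono2 powr_mono mult_right_mono) (auto simp: k_def intro: less_imp_le)
    also have "\<dots> < t" using j l0 by (simp add: field_simps)
    finally show ?thesis by blast
  qed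
  have ex_ge: "\<exists>k. t \<le> s k" if t: "t > 0" for t
  proof -
    obtain j :: int where j: "t / l 0 powr \<delta> \<le> 2 powr (- real_of_int j * (p1 * \<delta>))"
      using lim(2) [OF divide_pos_pos [OF t l0]] by blast
    define k where "k = min j 0"
    have "t \<le> l 0 powr \<delta> * 2 powr (- real_of_int j * (p1 * \<delta>))"
      using j l0 by (simp add: field_simps)
    also have "\<dots> \<le> s k"
      unfolding s_split using l par
      by (intro mult_mono powr_mono2 powr_mono mult_right_mono) (auto simp: k_def intro: less_imp_le)
    finally show ?thesis by blast
  qed
  \<comment> \<open>c^p bounds the K-functional; D^(\<theta> p) and one more D come from replacing t
    by s k / D in t^(-\<theta> p) and in 1 / t.\<close>
  define E where "E = c powr p * D powr (\<theta> * p + 1)"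
  define v where "v k = E * (l k * 2 powr (real_of_int k * (p - p1)))" for k
  have E: "E \<ge> 0" by (simp add: E_def)
  have v: "v k \<ge> 0" for k using l(1) [of k] E by (simp add: v_def)
  have integrand: "(t powr (- \<theta>) * K t) powr p / t \<le> v k / s k" if t: "s (k + 1) < t" "t \<le> s k" for t k
  proof -
    have t0: "t > 0" using t(1) spos [of "k + 1"] by linarith
    have "D * s (k + 1) \<le> D * t" using t D by simp
    then have "s k \<le> t * D" using s_D [of k] by (simp add: mult.commute)
    then have tD: "s k / D \<le> t" using D by (simp add: pos_divide_le_eq)
    have sD: "s k / D > 0" using spos D by simp
    have "K t \<le> c * l k powr (1 / p1)"
      using K(1) [OF t0 t(2)] Kl [of k] by linarith
    moreover have "t powr (- \<theta>) \<le> (s k / D) powr (- \<theta>)"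
      using sD tD par by (intro powr_mono2') auto
    ultimately have "t powr (- \<theta>) * K t \<le> (s k / D) powr (- \<theta>) * (c * l k powr (1 / p1))"
      using K(2) [OF t0] by (intro mult_mono) auto
    then have "(t powr (- \<theta>) * K t) powr p \<le> ((s k / D) powr (- \<theta>) * (c * l k powr (1 / p1))) powr p"
      using K(2) [OF t0] par by (intro powr_mono2) auto
    moreover have "1 / t \<le> D / s k"
      using tD sD t0 D spos [of k] by (simp add: field_simps)
    ultimately have "(t powr (- \<theta>) * K t) powr p * (1 / t)
       \<le> ((s k / D) powr (- \<theta>) * (c * l k powr (1 / p1))) powr p * (D / s k)"
      using t0 by (intro mult_mono) auto
    also have "((s k / D) powr (- \<theta>) * (c * l k powr (1 / p1))) powr p
       = c powr p * D powr (\<theta> * p) * (s k powr (- (\<theta> * p)) * l k powr (p / p1))"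
      using spos [of k] D l(1) [of k] par
      by (simp add: powr_mult powr_divide powr_powr powr_minus field_simps)
    also have "s k powr (- (\<theta> * p)) = l k powr (- (\<delta> * (\<theta> * p))) * 2 powr (real_of_int k * p1 * (\<delta> * (\<theta> * p)))"
      using l(1) [of k] by (simp add: s_def powr_divide powr_powr powr_minus field_simps)
    \<comment> \<open>Here the relation between the exponents enters: it makes the powers of l k
      collapse to l k itself.\<close>
    also have "\<delta> * (\<theta> * p) = p / p1 - 1"
      using par by (simp add: mult.assoc [symmetric] mult.commute [of \<delta>] left_diff_distrib)
    also have "l k powr (- (p / p1 - 1)) * 2 powr (real_of_int k * p1 * (p / p1 - 1)) * l k powr (p / p1)
      = l k * 2 powr (real_of_int k * (p - p1))"
    proof -
      have e: "real_of_int k * p1 * (p / p1 - 1) = real_of_int k * (p - p1)"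
        using par by (simp add: field_simps)
      have "l k powr (- (p / p1 - 1)) * l k powr (p / p1) = l k"
        using l(1) [of k] by (simp add: powr_add [symmetric])
      then show ?thesis unfolding e by (metis mult.assoc mult.commute)
    qed
    also have "c powr p * D powr (\<theta> * p) * (l k * 2 powr (real_of_int k * (p - p1))) * (D / s k) = v k / s k"
      using D by (simp add: v_def E_def powr_add)
    finally show ?thesis by simp
  qed
  have "(\<integral>\<^sup>+t\<in>{0<..}. ennreal ((t powr (- \<theta>) * K t) powr p / t) \<partial>lborel)
      \<le> (\<integral>\<^sup>+t. \<integral>\<^sup>+k. ennreal (v k / s k) * indicator {s (k + 1)<..s k} t \<partial>count_space (UNIV::int set) \<partial>lborel)"
  proof (rule nn_integral_mono)
    fix t :: real
    show "ennreal ((t powr (- \<theta>) * K t) powr p / t) * indicator {0<..} t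
       \<le> (\<integral>\<^sup>+k. ennreal (v k / s k) * indicator {s (k + 1)<..s k} t \<partial>count_space (UNIV::int set))"
    proof (cases "t > 0")
      case True
      obtain k where k: "s (k + 1) < t" "t \<le> s k"
        using dyadic_bracket [of s t] ex_less ex_ge True s_anti by blast
      have "ennreal ((t powr (- \<theta>) * K t) powr p / t) * indicator {0<..} t
          \<le> ennreal (v k / s k) * indicator {s (k + 1)<..s k} t"
        using integrand [OF k] k True by (simp add: ennreal_leI)
      also have "\<dots> \<le> (\<integral>\<^sup>+k. ennreal (v k / s k) * indicator {s (k + 1)<..s k} t \<partial>count_space (UNIV::int set))"
        by (rule nn_integral_ge_point) simp
      finally show ?thesis .
    qed simp
  qed
  also have "\<dots> = (\<integral>\<^sup>+k. \<integral>\<^sup>+t. ennreal (v k / s k) * indicator {s (k + 1)<..s k} t \<partial>lborel \<partial>count_space (UNIV::int set))"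
    by (rule nn_integral_count_space_nn_integral) auto
  also have "\<dots> \<le> (\<integral>\<^sup>+k. ennreal E * ennreal (l k * 2 powr (real_of_int k * (p - p1))) \<partial>count_space (UNIV::int set))"
  proof (rule nn_integral_mono)
    fix k :: int
    \<comment> \<open>The interval is no longer than s k, which cancels the denominator.\<close>
    have "(\<integral>\<^sup>+t. ennreal (v k / s k) * indicator {s (k + 1)<..s k} t \<partial>lborel)
        = ennreal (v k / s k) * ennreal (s k - s (k + 1))"
      using s_anti [of k "k + 1"] by (subst nn_integral_cmult_indicator) auto
    also have "\<dots> \<le> ennreal (v k / s k) * ennreal (s k)"
      using spos [of "k + 1"] by (intro mult_left_mono ennreal_leI) auto
    also have "\<dots> = ennreal (v k)"
      using spos [of k] v [of k] by (simp add: ennreal_mult [symmetric])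
    also have "\<dots> = ennreal E * ennreal (l k * 2 powr (real_of_int k * (p - p1)))"
      unfolding v_def using E l(1) [of k] by (simp add: ennreal_mult)
    finally show "(\<integral>\<^sup>+t. ennreal (v k / s k) * indicator {s (k + 1)<..s k} t \<partial>lborel)
      \<le> ennreal E * ennreal (l k * 2 powr (real_of_int k * (p - p1)))" by simp
  qed
  also have "\<dots> = ennreal E * (\<integral>\<^sup>+k. ennreal (l k * 2 powr (real_of_int k * (p - p1))) \<partial>count_space UNIV)"
    by (rule nn_integral_cmult) simp
  also have "E = c powr p * 2 powr ((N + p1) * \<delta> * (\<theta> * p + 1))"
    by (simp add: E_def D_def powr_powr)
  finally show ?thesis .
qed

text \<open>The hypothesis \<open>level\<close> says that the decreasing rearrangement of \<open>g\<close> at \<open>2 t ^ b\<close> is at most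
  \<open>h t\<close>. In the proof each \<open>x\<close> is charged to the interval \<open>(T x / 2, T x)\<close>, where \<open>T x\<close> is the point
  at which \<open>h\<close> crosses the level \<open>g x\<close>.\<close>

lemma K_integral_lower_bound:
  fixes K :: "real \<Rightarrow> real" and g w :: "'x \<Rightarrow> real" and a b c \<theta> p :: real
  defines "h \<equiv> \<lambda>t. c * K t * t powr (- a)"
  assumes K: "\<And>t. t > 0 \<Longrightarrow> K t \<ge> 0" "\<And>s t. 0 < s \<Longrightarrow> s \<le> t \<Longrightarrow> K t \<le> t / s * K s"
      "\<And>s t. 0 < s \<Longrightarrow> s \<le> t \<Longrightarrow> K s \<le> K t"
    and par: "a \<ge> 1" "b > 0" "c > 0" "p \<ge> 1" "\<theta> * p = a * p - b"
    and w: "\<And>x. w x > 0" and g: "\<And>x. g x \<ge> 0"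
    and level: "\<And>F t. finite F \<Longrightarrow> t > 0 \<Longrightarrow> (\<Sum>x | x \<in> F \<and> h t < g x. w x) \<le> 2 * t powr b"
    and fin: "(\<integral>\<^sup>+t\<in>{0<..}. ennreal ((t powr (- \<theta>) * K t) powr p / t) \<partial>lborel) < \<infinity>"
  shows "(\<integral>\<^sup>+x. ennreal (g x powr p * w x) \<partial>count_space UNIV)
     \<le> ennreal (4 * 2 powr b * c powr p) *
        (\<integral>\<^sup>+t\<in>{0<..}. ennreal ((t powr (- \<theta>) * K t) powr p / t) \<partial>lborel)"
proof -
  let ?f = "\<lambda>t. ennreal ((t powr (- \<theta>) * K t) powr p / t) * indicator {0<..} t"
  let ?I = "\<integral>\<^sup>+t. ?f t \<partial>lborel"
  have [measurable]: "?f \<in> borel_measurable borel"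
  proof -
    \<comment> \<open>Measurability comes from monotonicity, which is known for t > 0 only; as K is
      nonnegative there, extension by 0 stays monotone.\<close>
    define K' where "K' t = (if t > 0 then K t else 0)" for t
    have "mono K'" using K(1,3) by (auto simp: mono_def K'_def)
    then have [measurable]: "K' \<in> borel_measurable borel" by (rule borel_measurable_mono)
    have "?f = (\<lambda>t. ennreal ((t powr (- \<theta>) * K' t) powr p / t) * indicator {0<..} t)"
      by (auto simp: K'_def fun_eq_iff indicator_def)
    then show ?thesis by simp
  qed
  have cmult: "(\<integral>\<^sup>+t. k * ?f t \<partial>lborel) = k * ?I" for k
    by (rule nn_integral_cmult) simp
  have h0: "h t \<ge> 0" if "t > 0" for t using K(1) [OF that] par by (simp add: h_def)
  \<comment> \<open>K t / t is nonincreasing, and so is the remaining factor t^(1-a) because a \<ge>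
    1.\<close>
  have h_anti: "h t \<le> h s" if "0 < s" "s \<le> t" for s t
  proof -
    have "h t \<le> c * (t / s * K s) * t powr (- a)"
      unfolding h_def using K(2) [OF that] par by (intro mult_right_mono mult_left_mono) auto
    also have "\<dots> = c * K s / s * t powr (1 - a)"
      using that by (simp add: powr_diff powr_minus field_simps)
    also have "\<dots> \<le> c * K s / s * s powr (1 - a)"
      using that par K(1) [OF that(1)] by (intro mult_left_mono powr_mono2') auto
    also have "\<dots> = h s"
      using that by (simp add: h_def powr_diff powr_minus field_simps)
    finally show ?thesis .
  qed
  \<comment> \<open>Identifies the interpolation integrand, up to a factor, as the integral of h^p
    against the mass variable t^b.\<close>
  have hp: "h t powr p * t powr b / t = c powr p * ((t powr (- \<theta>) * K t) powr p / t)" if "t > 0" for t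
  proof -
    have "b - a * p = - (\<theta> * p)" using par by simp
    then show ?thesis
      using that K(1) [OF that] par
      by (simp add: h_def powr_mult powr_powr powr_add [symmetric] mult.assoc mult.left_commute)
  qed
  obtain I where I: "?I = ennreal I" "I \<ge> 0" using fin by (cases ?I) auto
  \<comment> \<open>Since h is antitone, its value at t is a lower bound on [t/2, t], and the finite
    integral over that interval limits it. This makes h tend to 0 at infinity, hence
    \<open>T x\<close> finite.\<close>
  have h_decay: "h t powr p * t powr b \<le> 2 * 2 powr b * c powr p * I" if "t > 0" for t
  proof -
    let ?v = "h t powr p * (t / 2) powr b / t"
    have "ennreal ?v * ennreal (t / 2) = (\<integral>\<^sup>+r. ennreal ?v * indicator {t/2..t} r \<partial>lborel)"
      using that by (subst nn_integral_cmult_indicator) auto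
    also have "\<dots> \<le> (\<integral>\<^sup>+r. ennreal (c powr p) * (ennreal ((r powr (- \<theta>) * K r) powr p / r) * indicator {0<..} r) \<partial>lborel)"
    proof (rule nn_integral_mono)
      fix r :: real
      show "ennreal ?v * indicator {t/2..t} r \<le> ennreal (c powr p) * (ennreal ((r powr (- \<theta>) * K r) powr p / r) * indicator {0<..} r)"
      proof (cases "r \<in> {t/2..t}")
        case True
        then have r: "r > 0" "t / 2 \<le> r" "r \<le> t" using that by auto
        have "?v \<le> h r powr p * r powr b / r"
          using r that par h0 h_anti by (intro frac_le mult_mono powr_mono2) auto
        then show ?thesis
          using r hp [OF r(1)] by (simp add: ennreal_leI ennreal_mult [symmetric])
      qed simp
    qed
    also have "\<dots> = ennreal (c powr p) * ?I"
      by (rule cmult)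
    also have "\<dots> = ennreal (c powr p * I)"
      using I by (simp add: ennreal_mult)
    finally have "?v * (t / 2) \<le> c powr p * I"
      using that I by (simp add: ennreal_mult [symmetric])
    then show ?thesis
      using that by (simp add: powr_divide field_simps)
  qed
  define M where "M = 2 * 2 powr b * c powr p * I"
  have M0: "M \<ge> 0" using I(2) by (simp add: M_def)
  define T where "T x = Sup {t. t > 0 \<and> g x \<le> h t}" for x
  have T: "T x > 0" "\<And>t. 0 < t \<Longrightarrow> t < T x \<Longrightarrow> g x \<le> h t" "\<And>t. t > T x \<Longrightarrow> h t < g x" if gx: "g x > 0" for x
  proof -
    let ?S = "{t. t > 0 \<and> g x \<le> h t}"
    have "\<exists>t0. t0 \<in> ?S"
    proof (rule ccontr)
      assume "\<nexists>t0. t0 \<in> ?S"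
      then have *: "h t < g x" if "t > 0" for t using that by (auto simp: not_le)
      \<comment> \<open>With this t the bound 2 t^b is w x / 2, too small for a level set containing
        x.\<close>
      define t where "t = (w x / 4) powr (1 / b)"
      have t: "t > 0" "t powr b = w x / 4" using w [of x] par by (auto simp: t_def powr_powr)
      have "{y. y \<in> {x} \<and> h t < g y} = {x}" using * [OF t(1)] by auto
      then have "w x \<le> 2 * t powr b" using level [of "{x}" t] t(1) by simp
      then show False using t w [of x] by simp
    qed
    then obtain t0 where t0: "t0 \<in> ?S" by blast
    have bdd: "bdd_above ?S"
    proof (rule bdd_aboveI)
      fix t assume "t \<in> ?S"
      then have t: "t > 0" "g x \<le> h t" by auto
      have "g x powr p * t powr b \<le> h t powr p * t powr b"
        using t gx par by (intro mult_right_mono powr_mono2) auto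
      also have "\<dots> \<le> M" using h_decay [OF t(1)] by (simp add: M_def)
      finally have "t powr b \<le> M / g x powr p" using gx by (simp add: field_simps)
      then have "(t powr b) powr (1 / b) \<le> (M / g x powr p) powr (1 / b)"
        using par by (intro powr_mono2) auto
      then show "t \<le> (M / g x powr p) powr (1 / b)" using par t by (simp add: powr_powr)
    qed
    show "T x > 0" using cSup_upper [OF t0 bdd] t0 by (simp add: T_def)
    show "g x \<le> h t" if t: "0 < t" "t < T x" for t
    proof -
      have "?S \<noteq> {}" using t0 by blast
      then obtain r where "r \<in> ?S" "t < r"
        using t(2) less_cSup_iff [OF _ bdd, of t] unfolding T_def by blast
      then show ?thesis using h_anti [of t r] t by simp
    qed
    show "h t < g x" if "t > T x" for t
    proof (rule ccontr)
      assume "\<not> h t < g x"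
      then have "t \<in> ?S" using that \<open>T x > 0\<close> by simp
      then have "t \<le> T x" unfolding T_def by (rule cSup_upper [OF _ bdd])
      then show False using that by simp
    qed
  qed
  show ?thesis
  proof (rule nn_integral_count_space_le_finite_sums)
    fix F :: "'x set" assume F: "finite F"
    define F' where "F' = {x\<in>F. g x > 0}"
    have F': "finite F'" "\<And>x. x \<in> F' \<Longrightarrow> g x > 0" using F by (auto simp: F'_def)
    \<comment> \<open>The interval has length T x / 2, so \<open>?u x\<close> has as integral
      exactly the contribution of x.\<close>
    let ?u = "\<lambda>x t. ennreal (2 * (g x powr p * w x) / T x) * indicator {T x / 2<..<T x} t"
    have u: "(\<integral>\<^sup>+t. ?u x t \<partial>lborel) = ennreal (g x powr p * w x)" if "x \<in> F'" for x
    proof -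
      have "T x > 0" using T(1) F' that by blast
      then show ?thesis
        using w [of x] by (subst nn_integral_cmult_indicator) (auto simp: ennreal_mult [symmetric] less_imp_le)
    qed
    have pt: "(\<Sum>x\<in>F'. ?u x t) \<le> ennreal (4 * 2 powr b * c powr p) * ?f t" for t
    proof (cases "t > 0")
      case True
      \<comment> \<open>Every x charged at t has T x < 2 t, hence exceeds the level h (2 t), and
        \<open>level\<close> bounds the total weight of such x by 2 (2 t)^b. On the other side t < T
        x gives g x \<le> h t.\<close>
      let ?G = "{x. x \<in> F \<and> h (2 * t) < g x}"
      let ?X = "{x\<in>F'. t \<in> {T x / 2<..<T x}}"
      have each: "2 * (g x powr p * w x) / T x \<le> 2 * (h t powr p / t) * w x" if "x \<in> ?X" for x
      proof -
        have x: "g x > 0" "t < T x" using that F' by auto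
        have "g x powr p / T x \<le> h t powr p / t"
          using T(2) [OF x(1) True x(2)] x True par by (intro frac_le powr_mono2) auto
        from mult_right_mono [OF this less_imp_le [OF w [of x]]] show ?thesis by simp
      qed
      have "(\<Sum>x\<in>F'. ?u x t) = (\<Sum>x\<in>?X. ennreal (2 * (g x powr p * w x) / T x))"
        using F'(1) by (intro sum.mono_neutral_cong_right) (auto simp: indicator_def)
      also have "\<dots> \<le> (\<Sum>x\<in>?X. ennreal (2 * (h t powr p / t) * w x))"
        using each by (intro sum_mono ennreal_leI) auto
      also have "\<dots> = ennreal (2 * (h t powr p / t) * (\<Sum>x\<in>?X. w x))"
        unfolding sum_distrib_left using True w by (intro sum_ennreal) (simp add: less_imp_le)
      also have "\<dots> \<le> ennreal (2 * (h t powr p / t) * (2 * (2 * t) powr b))"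
      proof (intro ennreal_leI mult_left_mono)
        have "?X \<subseteq> ?G"
        proof
          fix x assume "x \<in> ?X"
          then show "x \<in> ?G" using T(3) [of x "2 * t"] by (simp add: F'_def)
        qed
        then have "sum w ?X \<le> sum w ?G"
          using F w by (intro sum_mono2) (auto simp: less_imp_le)
        also have "\<dots> \<le> 2 * (2 * t) powr b" using level [OF F, of "2 * t"] True by simp
        finally show "sum w ?X \<le> 2 * (2 * t) powr b" .
      qed (use True in auto)
      also have "2 * (h t powr p / t) * (2 * (2 * t) powr b) = 4 * 2 powr b * (h t powr p * t powr b / t)"
        using True by (simp add: powr_mult)
      also have "\<dots> = 4 * 2 powr b * c powr p * ((t powr (- \<theta>) * K t) powr p / t)"
        unfolding hp [OF True] by simp
      also have "ennreal \<dots> = ennreal (4 * 2 powr b * c powr p) * ?f t"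
        using True by (subst ennreal_mult) auto
      finally show ?thesis .
    next
      case False
      then have "t \<notin> {T x / 2<..<T x}" if "x \<in> F'" for x
        using T(1) [of x] F' that by auto
      then show ?thesis by simp
    qed
    have "ennreal (\<Sum>x\<in>F. g x powr p * w x) = ennreal (\<Sum>x\<in>F'. g x powr p * w x)"
      unfolding F'_def using F g by (intro arg_cong [of _ _ ennreal] sum.mono_neutral_right) (auto simp: not_less order_antisym)
    also have "\<dots> = (\<Sum>x\<in>F'. ennreal (g x powr p * w x))"
      using w by (simp add: sum_ennreal less_imp_le)
    also have "\<dots> = (\<Sum>x\<in>F'. \<integral>\<^sup>+t. ?u x t \<partial>lborel)"
      using u by simp
    also have "\<dots> = (\<integral>\<^sup>+t. (\<Sum>x\<in>F'. ?u x t) \<partial>lborel)"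
      by (rule nn_integral_sum [symmetric]) simp
    also have "\<dots> \<le> (\<integral>\<^sup>+t. ennreal (4 * 2 powr b * c powr p) * ?f t \<partial>lborel)"
      by (intro nn_integral_mono pt)
    also have "\<dots> = ennreal (4 * 2 powr b * c powr p) * ?I"
      by (rule cmult)
    finally show "ennreal (\<Sum>x\<in>F. g x powr p * w x) \<le> ennreal (4 * 2 powr b * c powr p) * ?I" .
  qed (use w in \<open>auto simp: less_imp_le\<close>)
qed

section \<open>Homogeneous Sobolev spaces\<close>

context weighted_graph
begin

lemma Espace_ereal_iff: "f \<in> Espace \<mu> (ereal r) \<longleftrightarrow> moment \<mu> r (grad \<mu> f) < \<infinity>"
  unfolding Espace_def Lspace_def moment_def
  by (simp add: summable_on_iff_nn_integral)

lemma Eseminorm_ereal: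
  assumes "f \<in> Espace \<mu> (ereal r)"
  shows "Eseminorm \<mu> (ereal r) f = enn2real (moment \<mu> r (grad \<mu> f)) powr (1 / r)"
proof -
  have "(\<lambda>x. \<bar>grad \<mu> f x\<bar> powr r * vweight \<mu> x) summable_on UNIV"
    using assms by (simp add: Espace_def Lspace_def)
  then have "ennreal (\<Sum>\<^sub>\<infinity>x. \<bar>grad \<mu> f x\<bar> powr r * vweight \<mu> x) = moment \<mu> r (grad \<mu> f)"
    unfolding moment_def by (intro infsum_eq_nn_integral) auto
  moreover have "(\<Sum>\<^sub>\<infinity>x. \<bar>grad \<mu> f x\<bar> powr r * vweight \<mu> x) \<ge> 0"
    by (rule infsum_nonneg) simp
  ultimately have "(\<Sum>\<^sub>\<infinity>x. \<bar>grad \<mu> f x\<bar> powr r * vweight \<mu> x) = enn2real (moment \<mu> r (grad \<mu> f))"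
    by (metis enn2real_ennreal)
  then show ?thesis
    by (simp add: Eseminorm_def Lnorm_def)
qed

lemma Eseminorm_ereal_le:
  assumes "moment \<mu> r (grad \<mu> f) \<le> ennreal B" "B \<ge> 0" "r > 0"
  shows "f \<in> Espace \<mu> (ereal r)" "Eseminorm \<mu> (ereal r) f \<le> B powr (1 / r)"
proof -
  show f: "f \<in> Espace \<mu> (ereal r)"
    unfolding Espace_ereal_iff using assms(1) by (rule order.strict_trans1) simp
  show "Eseminorm \<mu> (ereal r) f \<le> B powr (1 / r)"
    unfolding Eseminorm_ereal [OF f] using assms by (intro powr_mono2) (auto simp: enn2real_leI)
qed

lemma Espace_PInf_iff: "f \<in> Espace \<mu> \<infinity> \<longleftrightarrow> bdd_above (range (grad \<mu> f))"
  by (simp add: Espace_def Lspace_def)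

lemma Eseminorm_PInf: "Eseminorm \<mu> \<infinity> f = (SUP x. grad \<mu> f x)"
  by (simp add: Eseminorm_def Lnorm_def)

lemma grad_le_Eseminorm_PInf: "f \<in> Espace \<mu> \<infinity> \<Longrightarrow> grad \<mu> f x \<le> Eseminorm \<mu> \<infinity> f"
  unfolding Eseminorm_PInf Espace_PInf_iff by (intro cSUP_upper) auto

lemma Eseminorm_PInf_le:
  assumes "\<And>x. grad \<mu> f x \<le> B"
  shows "f \<in> Espace \<mu> \<infinity>" "Eseminorm \<mu> \<infinity> f \<le> B"
  unfolding Eseminorm_PInf Espace_PInf_iff using assms by (auto intro!: cSUP_least bdd_aboveI)

lemma Eseminorm_nonneg:
  assumes "f \<in> Espace \<mu> r" "r > 0"
  shows "Eseminorm \<mu> r f \<ge> 0"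
proof (cases r)
  case (real r')
  then show ?thesis using assms by (simp add: Eseminorm_ereal)
next
  case PInf
  then show ?thesis using assms order_trans [OF grad_nonneg grad_le_Eseminorm_PInf [of f undefined]] by simp
qed (use assms in auto)

lemma chebyshev_Eseminorm:
  assumes f: "f \<in> Espace \<mu> (ereal r)" "Eseminorm \<mu> (ereal r) f \<le> k" and "r > 0" "l > 0" "finite F"
  shows "(\<Sum>x | x \<in> F \<and> l < grad \<mu> f x. vweight \<mu> x) \<le> (k / l) powr r"
proof -
  let ?X = "{x\<in>F. l < grad \<mu> f x}"
  obtain I where I: "moment \<mu> r (grad \<mu> f) = ennreal I" "I \<ge> 0"
    using f(1) unfolding Espace_ereal_iff by (cases "moment \<mu> r (grad \<mu> f)") auto
  have "l powr r * (\<Sum>x\<in>?X. vweight \<mu> x) \<le> (\<Sum>x\<in>?X. \<bar>grad \<mu> f x\<bar> powr r * vweight \<mu> x)"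
    unfolding sum_distrib_left using \<open>l > 0\<close> \<open>r > 0\<close>
    by (intro sum_mono mult_right_mono powr_mono2) auto
  also have "\<dots> \<le> I"
    using finite_sum_le_moment [of ?X "grad \<mu> f" r] \<open>finite F\<close> I by simp
  also have "I = (I powr (1 / r)) powr r"
    using I \<open>r > 0\<close> by (simp add: powr_powr)
  also have "\<dots> \<le> k powr r"
    using f I \<open>r > 0\<close> by (intro powr_mono2) (auto simp: Eseminorm_ereal)
  finally have *: "l powr r * (\<Sum>x\<in>?X. vweight \<mu> x) \<le> k powr r" .
  have "k \<ge> 0"
    using Eseminorm_nonneg [OF f(1)] f(2) \<open>r > 0\<close> by simp
  then show ?thesis
    using * \<open>l > 0\<close> by (simp add: powr_divide field_simps)
qed

lemma abs_in_Wspace_iff: "abs_fun_mod_const f \<in> Wspace \<mu> r \<longleftrightarrow> f \<in> Espace \<mu> r"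
proof
  assume "abs_fun_mod_const f \<in> Wspace \<mu> r"
  then obtain g where g: "g \<in> Espace \<mu> r" "abs_fun_mod_const f = abs_fun_mod_const g"
    by (auto simp: Wspace_def)
  then have "const_rel f g" by (simp add: fun_mod_const.abs_eq_iff)
  then show "f \<in> Espace \<mu> r"
    using g(1) grad_const_rel [of f g \<mu>] by (simp add: Espace_def)
qed (simp add: Wspace_def)

lemma Wspace_cases:
  assumes "F \<in> Wspace \<mu> r"
  obtains f where "F = abs_fun_mod_const f" "f \<in> Espace \<mu> r"
  using assms by (auto simp: Wspace_def)

lemma fun_mod_const_cases: obtains f where "F = abs_fun_mod_const f"
  by (metis Quotient3_abs_rep Quotient3_fun_mod_const)

end

text \<open>\<open>\<delta>\<close> is 1/p1 - 1/p2 with 1/\<infinity> read as 0; writing the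
  exponent relation through it lets finite and infinite p2 share one formula.\<close>

locale sobolev_interpolation = weighted_graph \<mu>
  for \<mu> :: "'a \<Rightarrow> 'a \<Rightarrow> real" +
  fixes p1 p \<theta> \<delta> :: real and p2 :: ereal
  assumes p1: "1 \<le> p1" "p1 < p" and p2: "ereal p < p2"
    and \<delta>: "\<delta> = 1 / p1 - (if p2 = \<infinity> then 0 else 1 / real_of_ereal p2)"
    and \<theta>: "\<theta> * \<delta> = 1 / p1 - 1 / p"
begin

lemma p2_cases:
  obtains (fin) r where "p2 = ereal r" "p < r" "\<delta> = 1 / p1 - 1 / r"
  | (inf) "p2 = \<infinity>" "\<delta> = 1 / p1"
  using p2 \<delta> by (cases p2) auto

lemma \<delta>_pos: "\<delta> > 0"
  using p1 by (cases rule: p2_cases) (auto intro!: divide_strict_left_mono)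

lemma \<theta>_nonneg: "\<theta> \<ge> 0"
proof -
  have "\<theta> * \<delta> \<ge> 0" using p1 by (simp add: \<theta> frac_le)
  then show ?thesis using \<delta>_pos by (simp add: zero_le_mult_iff)
qed

abbreviation "W1 \<equiv> Wspace \<mu> (ereal p1)"
abbreviation "W2 \<equiv> Wspace \<mu> p2"
abbreviation "M1 \<equiv> Wnorm \<mu> (ereal p1)"
abbreviation "M2 \<equiv> Wnorm \<mu> p2"

sublocale interpolation_pair W1 W2 M1 M2
proof
  have "0 < p2" using p1 p2 by (metis ereal_less(2) less_trans less_le_trans zero_less_one)
  then show "M2 F \<ge> 0" if "F \<in> W2" for F
    using that by (elim Wspace_cases) (simp add: Wnorm.abs_eq Eseminorm_nonneg)
  show "M1 F \<ge> 0" if "F \<in> W1" for F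
    using that p1 by (elim Wspace_cases) (simp add: Wnorm.abs_eq Eseminorm_nonneg)
qed

text \<open>The threshold is scaled so that the Chebyshev bounds at both endpoints come out as the
  same mass t^(1/\<delta>). For infinite p2 it equals k / t, which the gradient never
  exceeds.\<close>

lemma chebyshev_endpoint:
  assumes "f \<in> Espace \<mu> p2" "t * Eseminorm \<mu> p2 f \<le> k" "t > 0" "k > 0" "finite F"
  shows "(\<Sum>x | x \<in> F \<and> k * t powr (- (1 / (p1 * \<delta>))) < grad \<mu> f x. vweight \<mu> x) \<le> t powr (1 / \<delta>)"
proof (cases rule: p2_cases)
  case (fin r)
  have r: "r > 0" using fin p1 by simp
  have "(\<Sum>x | x \<in> F \<and> k * t powr (- (1 / (p1 * \<delta>))) < grad \<mu> f x. vweight \<mu> x)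
      \<le> ((k / t) / (k * t powr (- (1 / (p1 * \<delta>))))) powr r"
    using assms fin r by (intro chebyshev_Eseminorm) (auto simp: field_simps)
  also have "(k / t) / (k * t powr (- (1 / (p1 * \<delta>)))) = t powr (1 / (p1 * \<delta>) - 1)"
    using assms by (simp add: powr_diff powr_minus field_simps)
  also have "\<dots> powr r = t powr (1 / \<delta>)"
  proof -
    have "1 - p1 * \<delta> = p1 / r"
      using p1 r fin(3) by (simp add: field_simps)
    moreover have "(1 / (p1 * \<delta>) - 1) * r = (1 - p1 * \<delta>) * r / (p1 * \<delta>)"
      using \<delta>_pos p1 by (simp add: field_simps)
    ultimately have "(1 / (p1 * \<delta>) - 1) * r = 1 / \<delta>"
      using p1 r by simp
    then show ?thesis by (simp add: powr_powr)
  qed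
  finally show ?thesis .
next
  case inf
  have "1 / (p1 * \<delta>) = 1" using inf p1 by simp
  then have eq: "k * t powr (- (1 / (p1 * \<delta>))) = k / t"
    using assms(3) by (simp add: powr_minus field_simps)
  have "grad \<mu> f x \<le> k / t" for x
  proof -
    have "t * grad \<mu> f x \<le> t * Eseminorm \<mu> p2 f"
      using grad_le_Eseminorm_PInf [of f x] assms inf by (intro mult_left_mono) auto
    then have "t * grad \<mu> f x \<le> k" using assms by linarith
    then show ?thesis using assms by (simp add: pos_le_divide_eq mult.commute)
  qed
  then have "{x. x \<in> F \<and> k / t < grad \<mu> f x} = {}" by (auto simp: not_less)
  then show ?thesis unfolding eq by (simp only: sum.empty) simp
qed

text \<open>The factor 4 is 2 from \<open>grad_add_le\<close> times 2 from splitting a sum: where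
  the gradient of f exceeds 4 k T, that of one of the two parts exceeds k T.\<close>

lemma K_level_bound:
  fixes f :: "'a \<Rightarrow> real"
  assumes sum: "\<exists>a0\<in>W1. \<exists>a1\<in>W2. abs_fun_mod_const f = a0 + a1" and "t > 0" "finite F"
  shows "(\<Sum>x | x \<in> F \<and> 4 * K (abs_fun_mod_const f) t * t powr (- (1 / (p1 * \<delta>))) < grad \<mu> f x. vweight \<mu> x)
     \<le> 2 * t powr (1 / \<delta>)" (is "sum _ ?X \<le> _")
proof (cases "?X = {}")
  case True
  then show ?thesis by (simp only: sum.empty) simp
next
  case False
  define T where "T = t powr (- (1 / (p1 * \<delta>)))"
  have T: "T > 0" using \<open>t > 0\<close> by (simp add: T_def)
  have X: "?X = {x\<in>F. 4 * K (abs_fun_mod_const f) t * T < grad \<mu> f x}" by (simp add: T_def)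
  \<comment> \<open>On a finite set the strict inequalities hold with a common margin, which leaves
    room for a k above the possibly unattained, possibly zero infimum.\<close>
  define m where "m = Min (grad \<mu> f ` ?X)"
  have finX: "finite ?X" using \<open>finite F\<close> by simp
  then have m: "m \<in> grad \<mu> f ` ?X" "\<And>x. x \<in> ?X \<Longrightarrow> m \<le> grad \<mu> f x"
    unfolding m_def using False by (auto intro!: Min_in)
  then have "K (abs_fun_mod_const f) t < m / (4 * T)"
    using T m(1) [unfolded X] by (auto simp: pos_less_divide_eq mult_ac)
  then obtain k where k: "K (abs_fun_mod_const f) t < k" "k < m / (4 * T)"
    using dense by blast
  have k0: "k > 0" using K_nonneg [OF sum, of t] \<open>t > 0\<close> k(1) by linarith
  obtain a0 a1 where a: "a0 \<in> W1" "a1 \<in> W2" "abs_fun_mod_const f = a0 + a1" "M1 a0 + t * M2 a1 < k"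
    using K_lessD [OF sum k(1)] .
  obtain u where u: "a0 = abs_fun_mod_const u" "u \<in> Espace \<mu> (ereal p1)" using a(1) by (rule Wspace_cases)
  obtain v where v: "a1 = abs_fun_mod_const v" "v \<in> Espace \<mu> p2" using a(2) by (rule Wspace_cases)
  have "abs_fun_mod_const f = abs_fun_mod_const (\<lambda>x. u x + v x)"
    using a(3) u(1) v(1) by (simp add: plus_fun_mod_const.abs_eq)
  then have "grad \<mu> f = grad \<mu> (\<lambda>x. u x + v x)"
    by (intro grad_const_rel) (simp add: fun_mod_const.abs_eq_iff)
  then have grad_f: "grad \<mu> f x \<le> 2 * (grad \<mu> u x + grad \<mu> v x)" for x
    using grad_add_le by simp
  have "M1 a0 \<ge> 0" "t * M2 a1 \<ge> 0" using a N0_nonneg N1_nonneg \<open>t > 0\<close> by auto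
  then have le: "M1 a0 \<le> k" "t * M2 a1 \<le> k" using a(4) by auto
  have "?X \<subseteq> {x. x \<in> F \<and> k * T < grad \<mu> u x} \<union> {x. x \<in> F \<and> k * T < grad \<mu> v x}"
  proof
    fix x assume x: "x \<in> ?X"
    have "4 * (k * T) < m" using k(2) T by (simp add: field_simps)
    also have "\<dots> \<le> 2 * (grad \<mu> u x + grad \<mu> v x)" using m(2) [OF x] grad_f [of x] by linarith
    finally show "x \<in> {x. x \<in> F \<and> k * T < grad \<mu> u x} \<union> {x. x \<in> F \<and> k * T < grad \<mu> v x}"
      using x by auto
  qed
  then have "volume \<mu> ?X \<le> volume \<mu> ({x. x \<in> F \<and> k * T < grad \<mu> u x} \<union> {x. x \<in> F \<and> k * T < grad \<mu> v x})"
    using \<open>finite F\<close> by (intro volume_mono) auto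
  also have "\<dots> \<le> volume \<mu> {x. x \<in> F \<and> k * T < grad \<mu> u x} + volume \<mu> {x. x \<in> F \<and> k * T < grad \<mu> v x}"
    using \<open>finite F\<close> by (intro volume_Un_le) auto
  also have "volume \<mu> {x. x \<in> F \<and> k * T < grad \<mu> u x} \<le> (k / (k * T)) powr p1"
    unfolding volume_def using u le p1 k0 T \<open>finite F\<close>
    by (intro chebyshev_Eseminorm) (auto simp: Wnorm.abs_eq)
  also have "(k / (k * T)) powr p1 = t powr (1 / \<delta>)"
    using k0 p1 by (simp add: T_def powr_minus powr_powr divide_inverse [symmetric] powr_divide)
  also have "volume \<mu> {x. x \<in> F \<and> k * T < grad \<mu> v x} \<le> t powr (1 / \<delta>)"
    unfolding volume_def T_def using v le k0 \<open>t > 0\<close> \<open>finite F\<close>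
    by (intro chebyshev_endpoint) (auto simp: Wnorm.abs_eq)
  finally show ?thesis by (simp add: volume_def)
qed

abbreviation "interp_int \<equiv> interp_integral W1 M1 W2 M2 \<theta> p"

lemma moment_grad_le_interp_integral:
  assumes sum: "\<exists>a0\<in>W1. \<exists>a1\<in>W2. abs_fun_mod_const f = a0 + a1" and fin: "interp_int (abs_fun_mod_const f) < \<infinity>"
  shows "moment \<mu> p (grad \<mu> f) \<le> ennreal (4 * 2 powr (1 / \<delta>) * 4 powr p) * interp_int (abs_fun_mod_const f)"
proof -
  \<comment> \<open>p1 \<delta> = 1 - p1/p2 is at most 1; this is the condition a \<ge> 1 behind the
    monotonicity of the level function.\<close>
  have "1 / (p1 * \<delta>) \<ge> 1"
  proof (cases rule: p2_cases)
    case (fin r)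
    have "p1 * \<delta> = 1 - p1 / r" using fin(3) p1 by (simp add: field_simps)
    then have "p1 * \<delta> \<le> 1" using fin p1 by simp
    then show ?thesis using \<delta>_pos p1 by simp
  qed (use p1 in auto)
  moreover have "\<theta> * p = 1 / (p1 * \<delta>) * p - 1 / \<delta>"
    using \<theta> \<delta>_pos p1 by (simp add: field_simps)
  ultimately have "(\<integral>\<^sup>+x. ennreal (grad \<mu> f x powr p * vweight \<mu> x) \<partial>count_space UNIV)
     \<le> ennreal (4 * 2 powr (1 / \<delta>) * 4 powr p) *
      (\<integral>\<^sup>+t\<in>{0<..}. ennreal ((t powr (- \<theta>) * K (abs_fun_mod_const f) t) powr p / t) \<partial>lborel)"
    using sum fin \<delta>_pos p1 vweight_pos unfolding interp_integral_def
    by (intro K_integral_lower_bound [where a = "1 / (p1 * \<delta>)"] K_level_bound K_nonneg K_mono K_div_antimono) auto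
  then show ?thesis by (simp add: moment_def interp_integral_def)
qed

text \<open>Above the level a = 2^k the integrand is h^p1, below it h^(p1+N) / a^N. For N = p2 - p1
  it thus measures the large values in the p1-norm and the small ones in the p2-norm.\<close>

definition truncated_moment :: "real \<Rightarrow> ('a \<Rightarrow> real) \<Rightarrow> int \<Rightarrow> ennreal" where
  "truncated_moment N h k =
     (\<integral>\<^sup>+x. ennreal (h x powr p1 * min 1 ((h x / 2 powr real_of_int k) powr N) * vweight \<mu> x) \<partial>count_space UNIV)"

lemma truncated_moment_antimono:
  assumes "\<And>x. h x \<ge> 0" "N > 0" "j \<le> k"
  shows "truncated_moment N h k \<le> truncated_moment N h j"
  unfolding truncated_moment_def
proof (intro nn_integral_mono ennreal_leI mult_right_mono mult_left_mono min.mono)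
  show "(h x / 2 powr real_of_int k) powr N \<le> (h x / 2 powr real_of_int j) powr N" for x
    using assms by (intro powr_mono2 divide_left_mono) auto
qed auto

lemma truncated_moment_Suc:
  assumes "\<And>x. h x \<ge> 0" "N > 0"
  shows "truncated_moment N h k \<le> ennreal (2 powr N) * truncated_moment N h (k + 1)"
proof -
  have "min 1 ((h x / 2 powr real_of_int k) powr N) \<le> 2 powr N * min 1 ((h x / 2 powr real_of_int (k + 1)) powr N)" for x
  proof -
    have "(h x / 2 powr real_of_int k) = 2 * (h x / 2 powr real_of_int (k + 1))"
      by (simp add: powr_add)
    then have "(h x / 2 powr real_of_int k) powr N = 2 powr N * (h x / 2 powr real_of_int (k + 1)) powr N"
      using assms by (metis divide_nonneg_nonneg powr_ge_zero powr_mult zero_le_numeral)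
    moreover have "1 \<le> 2 powr N" using assms by (intro ge_one_powr_ge_zero) auto
    ultimately show ?thesis
      by (simp add: min_mult_distrib_left le_infI1 min.coboundedI1)
  qed
  then have "h x powr p1 * min 1 ((h x / 2 powr real_of_int k) powr N) * vweight \<mu> x
      \<le> h x powr p1 * (2 powr N * min 1 ((h x / 2 powr real_of_int (k + 1)) powr N)) * vweight \<mu> x" for x
    by (intro mult_right_mono mult_left_mono) auto
  then have "truncated_moment N h k \<le> (\<integral>\<^sup>+x. ennreal (2 powr N) *
      ennreal (h x powr p1 * min 1 ((h x / 2 powr real_of_int (k + 1)) powr N) * vweight \<mu> x) \<partial>count_space UNIV)"
    unfolding truncated_moment_def by (intro nn_integral_mono) (simp add: ennreal_mult [symmetric] mult_ac)
  then show ?thesis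
    by (simp add: truncated_moment_def nn_integral_cmult)
qed

text \<open>min(1, u^N) \<le> u^(p-p1) holds for all u \<ge> 0 when N \<ge> p - p1, and h^p1
  (h/a)^(p-p1) is a multiple of h^p.\<close>

lemma truncated_moment_finite:
  assumes "\<And>x. h x \<ge> 0" "N \<ge> p - p1" "moment \<mu> p h < \<infinity>"
  shows "truncated_moment N h k < \<infinity>"
proof -
  define a where "a = 2 powr real_of_int k"
  have a: "a > 0" by (simp add: a_def)
  have "h x powr p1 * min 1 ((h x / a) powr N) \<le> a powr (p1 - p) * \<bar>h x\<bar> powr p" for x
  proof -
    have "min 1 ((h x / a) powr N) \<le> (h x / a) powr (p - p1)"
    proof (cases "h x \<le> a")
      case True
      then have "(h x / a) powr N \<le> (h x / a) powr (p - p1)"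
        using assms a p1 by (cases "h x = 0") (auto intro!: powr_mono')
      then show ?thesis by simp
    next
      case False
      then have "1 \<le> (h x / a) powr (p - p1)"
        using a p1 by (intro ge_one_powr_ge_zero) auto
      then show ?thesis by simp
    qed
    then have "h x powr p1 * min 1 ((h x / a) powr N) \<le> h x powr p1 * (h x / a) powr (p - p1)"
      by (rule mult_left_mono) simp
    also have "\<dots> = a powr (p1 - p) * \<bar>h x\<bar> powr p"
      using assms(1) [of x] a by (simp add: powr_divide powr_diff)
    finally show ?thesis .
  qed
  then have "h x powr p1 * min 1 ((h x / a) powr N) * vweight \<mu> x
     \<le> a powr (p1 - p) * (\<bar>h x\<bar> powr p * vweight \<mu> x)" for x
    unfolding mult.assoc [symmetric] by (rule mult_right_mono) simp
  then have "truncated_moment N h k \<le> (\<integral>\<^sup>+x. ennreal (a powr (p1 - p)) * ennreal (\<bar>h x\<bar> powr p * vweight \<mu> x) \<partial>count_space UNIV)"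
    unfolding truncated_moment_def a_def [symmetric] by (intro nn_integral_mono) (simp add: ennreal_mult [symmetric])
  also have "\<dots> = ennreal (a powr (p1 - p)) * moment \<mu> p h"
    by (simp add: moment_def nn_integral_cmult)
  also have "\<dots> < \<infinity>" using assms(3) by (simp add: ennreal_mult_less_top)
  finally show ?thesis .
qed

lemma truncated_moment_pos:
  assumes "h x > 0"
  shows "truncated_moment N h k > 0"
proof -
  have "0 < ennreal (h x powr p1 * min 1 ((h x / 2 powr real_of_int k) powr N) * vweight \<mu> x)"
    using assms vweight_pos [of x] by (auto simp: min_def)
  also have "\<dots> \<le> truncated_moment N h k"
    unfolding truncated_moment_def by (rule nn_integral_ge_point) simp
  finally show ?thesis .
qed

text \<open>After exchanging sums, each x carries h^p1 times a dyadic sum of order h^(p-p1); the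
  condition on N is what makes that sum converge.\<close>

lemma sum_truncated_moment_le:
  assumes "N > p - p1"
  obtains C where "C > 0" "\<And>h. (\<And>x. h x \<ge> 0) \<Longrightarrow>
    (\<integral>\<^sup>+k. truncated_moment N h k * ennreal (2 powr (real_of_int k * (p - p1))) \<partial>count_space UNIV)
      \<le> ennreal C * moment \<mu> p h"
proof -
  obtain C where C: "C > 0"
    "\<And>y. y \<ge> 0 \<Longrightarrow> (\<integral>\<^sup>+k. ennreal (2 powr (real_of_int k * (p - p1)) * min 1 ((y / 2 powr real_of_int k) powr N))
              \<partial>count_space UNIV) \<le> ennreal (C * y powr (p - p1))"
    using dyadic_sum_bound [of "p - p1" N] p1 assms by auto
  show ?thesis
  proof (rule that [OF C(1)])
    fix h :: "'a \<Rightarrow> real" assume h: "\<And>x. h x \<ge> 0"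
    let ?m = "\<lambda>k x. min 1 ((h x / 2 powr real_of_int k) powr N)"
    let ?a = "\<lambda>k. 2 powr (real_of_int k * (p - p1))"
    have "(\<integral>\<^sup>+k. truncated_moment N h k * ennreal (?a k) \<partial>count_space UNIV)
       = (\<integral>\<^sup>+k. \<integral>\<^sup>+x. ennreal (h x powr p1 * vweight \<mu> x) * ennreal (?a k * ?m k x)
            \<partial>count_space UNIV \<partial>count_space UNIV)"
    proof (rule nn_integral_cong)
      fix k :: int
      have "truncated_moment N h k * ennreal (?a k)
        = (\<integral>\<^sup>+x. ennreal (h x powr p1 * ?m k x * vweight \<mu> x) * ennreal (?a k) \<partial>count_space UNIV)"
        unfolding truncated_moment_def by (rule nn_integral_multc [symmetric]) simp
      also have "\<dots> = (\<integral>\<^sup>+x. ennreal (h x powr p1 * vweight \<mu> x) * ennreal (?a k * ?m k x) \<partial>count_space UNIV)"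
        by (intro nn_integral_cong) (simp add: ennreal_mult [symmetric] mult_ac)
      finally show "truncated_moment N h k * ennreal (?a k) = \<dots>" .
    qed
    also have "\<dots> = (\<integral>\<^sup>+x. \<integral>\<^sup>+k. ennreal (h x powr p1 * vweight \<mu> x) * ennreal (?a k * ?m k x)
            \<partial>count_space UNIV \<partial>count_space UNIV)"
      by (rule nn_integral_count_space_nn_integral [symmetric]) auto
    also have "\<dots> \<le> (\<integral>\<^sup>+x. ennreal C * ennreal (\<bar>h x\<bar> powr p * vweight \<mu> x) \<partial>count_space UNIV)"
    proof (rule nn_integral_mono)
      fix x
      have "(\<integral>\<^sup>+k. ennreal (h x powr p1 * vweight \<mu> x) * ennreal (?a k * ?m k x) \<partial>count_space UNIV)
          \<le> ennreal (h x powr p1 * vweight \<mu> x) * ennreal (C * h x powr (p - p1))"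
        using C(2) [OF h [of x]] by (subst nn_integral_cmult) (auto intro!: mult_left_mono)
      also have "\<dots> = ennreal (C * (\<bar>h x\<bar> powr p * vweight \<mu> x))"
        using C(1) h [of x] by (simp add: ennreal_mult [symmetric] powr_diff)
      also have "\<dots> = ennreal C * ennreal (\<bar>h x\<bar> powr p * vweight \<mu> x)"
        using C(1) by (simp add: ennreal_mult)
      finally show "(\<integral>\<^sup>+k. ennreal (h x powr p1 * vweight \<mu> x) * ennreal (?a k * ?m k x) \<partial>count_space UNIV)
          \<le> ennreal C * ennreal (\<bar>h x\<bar> powr p * vweight \<mu> x)" .
    qed
    also have "\<dots> = ennreal C * moment \<mu> p h"
      by (simp add: moment_def nn_integral_cmult)
    finally show "(\<integral>\<^sup>+k. truncated_moment N h k * ennreal (?a k) \<partial>count_space UNIV) \<le> ennreal C * moment \<mu> p h" .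
  qed
qed

text \<open>Where h > 2^k the weight in \<open>truncated_moment\<close> equals 1, and elsewhere the
  gradient of b vanishes.\<close>

lemma bad_part_bound:
  assumes "\<And>x. h x \<ge> 0" "truncated_moment N h k = ennreal l" "l \<ge> 0" "A \<ge> 0" "N > 0"
    and b: "\<And>x. grad \<mu> b x \<le> A * (of_bool (h x > 2 powr real_of_int k) * h x)"
  shows "b \<in> Espace \<mu> (ereal p1)" "Eseminorm \<mu> (ereal p1) b \<le> A * l powr (1 / p1)"
proof -
  define a where "a = 2 powr real_of_int k"
  have a: "a > 0" by (simp add: a_def)
  have pt: "\<bar>grad \<mu> b x\<bar> powr p1 * vweight \<mu> x
      \<le> A powr p1 * (h x powr p1 * min 1 ((h x / a) powr N) * vweight \<mu> x)" for x
  proof -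
    have "\<bar>grad \<mu> b x\<bar> powr p1 \<le> (A * (of_bool (h x > a) * h x)) powr p1"
      using b [of x] p1 by (intro powr_mono2) (auto simp: a_def)
    also have "\<dots> \<le> A powr p1 * (h x powr p1 * min 1 ((h x / a) powr N))"
    proof (cases "h x > a")
      case True
      then have "1 \<le> (h x / a) powr N" using a assms by (intro ge_one_powr_ge_zero) auto
      then show ?thesis using True assms by (simp add: powr_mult)
    qed simp
    finally show ?thesis
      unfolding mult.assoc [symmetric] by (rule mult_right_mono) simp
  qed
  have "moment \<mu> p1 (grad \<mu> b) \<le> (\<integral>\<^sup>+x. ennreal (A powr p1) *
      ennreal (h x powr p1 * min 1 ((h x / a) powr N) * vweight \<mu> x) \<partial>count_space UNIV)"
    unfolding moment_def using pt by (intro nn_integral_mono) (simp add: ennreal_mult [symmetric])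
  also have "\<dots> = ennreal (A powr p1 * l)"
    using assms by (simp add: nn_integral_cmult truncated_moment_def a_def ennreal_mult)
  finally have *: "moment \<mu> p1 (grad \<mu> b) \<le> ennreal (A powr p1 * l)" .
  show "b \<in> Espace \<mu> (ereal p1)"
    using Eseminorm_ereal_le(1) [OF *] assms p1 by simp
  have "Eseminorm \<mu> (ereal p1) b \<le> (A powr p1 * l) powr (1 / p1)"
    using Eseminorm_ereal_le(2) [OF *] assms p1 by simp
  also have "\<dots> = A * l powr (1 / p1)"
    using assms p1 by (simp add: powr_mult powr_powr)
  finally show "Eseminorm \<mu> (ereal p1) b \<le> A * l powr (1 / p1)" .
qed

text \<open>Any exponent larger than \<open>p - p1\<close> would do when \<open>p2 = \<infinity>\<close>.\<close>

definition truncation_exponent :: real where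
  "truncation_exponent = (if p2 = \<infinity> then p else real_of_ereal p2 - p1)"

lemma truncation_exponent_gt: "truncation_exponent > p - p1"
  unfolding truncation_exponent_def using p1 by (cases rule: p2_cases) auto

text \<open>For finite p2 = r, min(h, a)^r \<le> a^(r-p1) h^p1 min(1, (h/a)^(r-p1)), and the r-th
  root uses (r - p1) / r = p1 \<delta> and 1/r = 1/p1 - \<delta>. For infinite p2 these exponents
  are 1 and 0, and the bound reads A * a.\<close>

lemma good_part_bound:
  assumes h: "\<And>x. h x \<ge> 0" and l: "truncated_moment truncation_exponent h k = ennreal l" "l > 0" and "A \<ge> 0"
    and g: "\<And>x. grad \<mu> g x \<le> A * min (h x) (2 powr real_of_int k)"
  shows "g \<in> Espace \<mu> p2"
    "Eseminorm \<mu> p2 g \<le> A * (2 powr (real_of_int k * p1)) powr \<delta> * l powr (1 / p1 - \<delta>)"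
proof -
  define a where "a = 2 powr real_of_int k"
  have a: "a > 0" by (simp add: a_def)
  have a_pow: "(2 powr (real_of_int k * p1)) powr \<delta> = a powr (p1 * \<delta>)"
    by (simp add: a_def powr_powr mult.assoc)
  have "g \<in> Espace \<mu> p2 \<and> Eseminorm \<mu> p2 g \<le> A * a powr (p1 * \<delta>) * l powr (1 / p1 - \<delta>)"
  proof (cases rule: p2_cases)
    case (fin r)
    have N: "truncation_exponent = r - p1" unfolding truncation_exponent_def by (simp add: fin(1))
    have r: "r > 0" "r > p1" using fin p1 by auto
    have pt: "\<bar>grad \<mu> g x\<bar> powr r * vweight \<mu> x
      \<le> A powr r * a powr (r - p1) * (h x powr p1 * min 1 ((h x / a) powr (r - p1)) * vweight \<mu> x)" for x
    proof -
      have "\<bar>grad \<mu> g x\<bar> powr r \<le> (A * min (h x) a) powr r"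
        using g [of x] r by (intro powr_mono2) (auto simp: a_def)
      also have "\<dots> = A powr r * min (h x) a powr r"
        using h [of x] a \<open>A \<ge> 0\<close> by (intro powr_mult)
      also have "min (h x) a powr r \<le> a powr (r - p1) * (h x powr p1 * min 1 ((h x / a) powr (r - p1)))"
      proof (cases "h x > a")
        case True
        then have "1 \<le> (h x / a) powr (r - p1)" using a r by (intro ge_one_powr_ge_zero) auto
        moreover have "a powr (r - p1) * a powr p1 \<le> a powr (r - p1) * h x powr p1"
          using True a p1 by (intro mult_left_mono powr_mono2) auto
        ultimately show ?thesis using True a by (simp add: powr_add [symmetric])
      next
        case False
        then have "(h x / a) powr (r - p1) \<le> 1"
          using a r h [of x] by (intro powr_le1) auto
        moreover have "h x powr r = a powr (r - p1) * (h x powr p1 * (h x / a) powr (r - p1))"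
          using a h [of x] by (simp add: powr_divide powr_diff)
        ultimately show ?thesis using False by (simp add: min_def)
      qed
      finally have "\<bar>grad \<mu> g x\<bar> powr r
          \<le> A powr r * (a powr (r - p1) * (h x powr p1 * min 1 ((h x / a) powr (r - p1))))"
        by (simp add: mult_left_mono)
      then show ?thesis
        unfolding mult.assoc [symmetric] by (rule mult_right_mono) simp
    qed
    have "moment \<mu> r (grad \<mu> g) \<le> (\<integral>\<^sup>+x. ennreal (A powr r * a powr (r - p1)) *
        ennreal (h x powr p1 * min 1 ((h x / a) powr (r - p1)) * vweight \<mu> x) \<partial>count_space UNIV)"
      unfolding moment_def using pt by (intro nn_integral_mono) (simp add: ennreal_mult [symmetric])
    also have "\<dots> = ennreal (A powr r * a powr (r - p1) * l)"
      using l by (simp add: nn_integral_cmult truncated_moment_def a_def N ennreal_mult less_imp_le)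
    finally have *: "moment \<mu> r (grad \<mu> g) \<le> ennreal (A powr r * a powr (r - p1) * l)" .
    have "Eseminorm \<mu> (ereal r) g \<le> (A powr r * a powr (r - p1) * l) powr (1 / r)"
      using Eseminorm_ereal_le(2) [OF *] l r by simp
    also have "\<dots> = A * a powr ((r - p1) * (1 / r)) * l powr (1 / r)"
      using l r \<open>A \<ge> 0\<close> by (simp add: powr_mult powr_powr)
    also have "(r - p1) * (1 / r) = p1 * \<delta>"
      using fin(3) r p1 by (simp add: field_simps)
    also have "1 / r = 1 / p1 - \<delta>" using fin(3) by simp
    finally show ?thesis
      using fin(1) Eseminorm_ereal_le(1) [OF *] l r by simp
  next
    case inf
    have "grad \<mu> g x \<le> A * a" for x
      using g [of x] mult_left_mono [OF min.cobounded2 [of "h x" a] \<open>A \<ge> 0\<close>] by (simp add: a_def)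
    then show ?thesis
      using Eseminorm_PInf_le [of g "A * a"] inf a p1 l by simp
  qed
  then show "g \<in> Espace \<mu> p2"
    "Eseminorm \<mu> p2 g \<le> A * (2 powr (real_of_int k * p1)) powr \<delta> * l powr (1 / p1 - \<delta>)"
    by (simp_all only: a_pow)
qed

lemma interp_integral_le_moment_grad:
  assumes "doubling \<mu>" "Delta_cond \<mu> \<alpha>" "\<alpha> > 0" "poincare \<mu> s" "1 \<le> s" "s < p1"
  obtains C where "C > 0" "\<And>f. moment \<mu> p (grad \<mu> f) < \<infinity> \<Longrightarrow>
    (\<exists>a0\<in>W1. \<exists>a1\<in>W2. abs_fun_mod_const f = a0 + a1) \<and>
    interp_int (abs_fun_mod_const f) \<le> ennreal C * moment \<mu> p (grad \<mu> f)"
proof -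
  obtain A where A: "A > 0" "\<And>f. moment \<mu> p (grad \<mu> f) < \<infinity> \<Longrightarrow>
    \<exists>h. (\<forall>x. h x \<ge> 0) \<and> moment \<mu> p h \<le> ennreal A * moment \<mu> p (grad \<mu> f) \<and>
      (\<forall>l>0. \<exists>b g. (\<forall>x. f x = b x + g x) \<and> (\<forall>x. grad \<mu> b x \<le> A * (of_bool (h x > l) * h x)) \<and>
        (\<forall>x. grad \<mu> g x \<le> A * min (h x) l))"
    using lipschitz_truncation [OF assms(1-5) less_trans [OF assms(6) p1(2)]] by blast
  define N where "N = truncation_exponent"
  have N: "N > p - p1" "N > 0" using truncation_exponent_gt p1 by (auto simp: N_def)
  obtain C where C: "C > 0" "\<And>h. (\<And>x. h x \<ge> 0) \<Longrightarrow>
    (\<integral>\<^sup>+k. truncated_moment N h k * ennreal (2 powr (real_of_int k * (p - p1))) \<partial>count_space UNIV)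
      \<le> ennreal C * moment \<mu> p h"
    using sum_truncated_moment_le [OF N(1)] by blast
  define B where "B = (2 * A) powr p * 2 powr ((N + p1) * \<delta> * (\<theta> * p + 1))"
  have B: "B > 0" using A(1) by (simp add: B_def)
  show ?thesis
  proof (rule that)
    show "B * C * A > 0" using A C B by simp
    fix f :: "'a \<Rightarrow> real" assume fin: "moment \<mu> p (grad \<mu> f) < \<infinity>"
    let ?F = "abs_fun_mod_const f"
    obtain h where h: "\<And>x. h x \<ge> 0" and moment_h: "moment \<mu> p h \<le> ennreal A * moment \<mu> p (grad \<mu> f)"
      and trunc: "\<And>l. l > 0 \<Longrightarrow> \<exists>b g. (\<forall>x. f x = b x + g x) \<and>
        (\<forall>x. grad \<mu> b x \<le> A * (of_bool (h x > l) * h x)) \<and> (\<forall>x. grad \<mu> g x \<le> A * min (h x) l)"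
      using A(2) [OF fin] by blast
    have fin_h: "moment \<mu> p h < \<infinity>"
      by (rule order.strict_trans1 [OF moment_h]) (use fin in \<open>simp add: ennreal_mult_less_top\<close>)
    show "(\<exists>a0\<in>W1. \<exists>a1\<in>W2. ?F = a0 + a1) \<and> interp_int ?F \<le> ennreal (B * C * A) * moment \<mu> p (grad \<mu> f)"
    proof (cases "\<exists>x. h x > 0")
      \<comment> \<open>If h = 0, all truncated moments vanish and no positive parameters can be
        attached to the levels. But then f has zero gradient, and its K-functional is 0.\<close>
      case False
      then have h_zero: "h x = 0" for x using h [of x] by (meson not_less order_antisym)
      obtain b g where bg: "\<And>x. f x = b x + g x" "\<And>x. grad \<mu> b x \<le> A * (of_bool (h x > 1) * h x)"
          "\<And>x. grad \<mu> g x \<le> A * min (h x) 1"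
        using trunc [of 1] by auto
      have "grad \<mu> f x \<le> 0" for x
      proof -
        have "f = (\<lambda>x. b x + g x)" using bg(1) by auto
        then have "grad \<mu> f x \<le> 2 * (grad \<mu> b x + grad \<mu> g x)" using grad_add_le by simp
        then show ?thesis using bg(2,3) [of x] h_zero [of x] by simp
      qed
      then have "grad \<mu> f x = 0" for x by (meson grad_nonneg order_antisym)
      then have f: "moment \<mu> p1 (grad \<mu> f) \<le> ennreal 0" by (simp add: moment_def)
      have f1: "f \<in> Espace \<mu> (ereal p1)" "Eseminorm \<mu> (ereal p1) f \<le> 0"
        using Eseminorm_ereal_le [OF f] p1 by auto
      let ?Z = "abs_fun_mod_const (\<lambda>_. 0) :: 'a fun_mod_const"
      have grad_zero: "grad \<mu> (\<lambda>_. 0) x = 0" for x by (simp add: grad_def)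
      have zero: "(\<lambda>_. 0) \<in> Espace \<mu> p2 \<and> Eseminorm \<mu> p2 (\<lambda>_. 0) \<le> 0"
      proof (cases rule: p2_cases)
        case (fin r)
        then show ?thesis
          using Eseminorm_ereal_le [of r "\<lambda>_. 0" 0] p1 by (simp add: moment_def grad_zero)
      next
        case inf
        then show ?thesis
          using Eseminorm_PInf_le [of "\<lambda>_. 0" 0] by (simp add: grad_zero)
      qed
      have F: "?F = ?F + ?Z" by (simp add: plus_fun_mod_const.abs_eq)
      have mem: "?F \<in> W1" "?Z \<in> W2" using f1(1) zero by (simp_all add: abs_in_Wspace_iff)
      have sum: "\<exists>a0\<in>W1. \<exists>a1\<in>W2. ?F = a0 + a1" using F mem by blast
      have K0: "K ?F t = 0" if "t > 0" for t
      proof -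
        have "K ?F t \<le> M1 ?F + t * M2 ?Z"
          using K_le [OF mem, of t] that F by simp
        also have "\<dots> \<le> 0 + t * 0"
          using f1(2) zero that by (intro add_mono mult_left_mono) (auto simp: Wnorm.abs_eq)
        finally show ?thesis using K_nonneg [OF sum, of t] that by simp
      qed
      have "interp_int ?F = (\<integral>\<^sup>+t. 0 \<partial>(lborel :: real measure))"
        unfolding interp_integral_def by (intro nn_integral_cong) (auto simp: K0 indicator_def)
      then show ?thesis using sum by simp
    next
      case True
      then obtain x0 where x0: "h x0 > 0" by blast
      define l where "l k = enn2real (truncated_moment N h k)" for k
      have l: "truncated_moment N h k = ennreal (l k)" "l k > 0" for k
        using truncated_moment_pos [of h x0 N k, OF x0] truncated_moment_finite [of h N k, OF h _ fin_h] N
        by (auto simp: l_def enn2real_positive_iff)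
      \<comment> \<open>At this parameter the bounds for the bad part and for s k times the good
        part are both A * l k powr (1 / p1).\<close>
      define s where "s k = (l k / 2 powr (real_of_int k * p1)) powr \<delta>" for k
      have spos: "s k > 0" for k using l(2) [of k] by (simp add: s_def)
      have dec: "\<exists>a0\<in>W1. \<exists>a1\<in>W2. ?F = a0 + a1 \<and> M1 a0 + s k * M2 a1 \<le> 2 * A * l k powr (1 / p1)" for k
      proof -
        obtain b g where bg: "\<And>x. f x = b x + g x"
            "\<And>x. grad \<mu> b x \<le> A * (of_bool (h x > 2 powr real_of_int k) * h x)"
            "\<And>x. grad \<mu> g x \<le> A * min (h x) (2 powr real_of_int k)"
          using trunc [of "2 powr real_of_int k"] by auto
        have b: "b \<in> Espace \<mu> (ereal p1)" "Eseminorm \<mu> (ereal p1) b \<le> A * l k powr (1 / p1)"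
          using bad_part_bound [of h N k "l k" A b, OF h l(1) less_imp_le [OF l(2)] _ N(2) bg(2)] A(1) by auto
        have g: "g \<in> Espace \<mu> p2"
          "Eseminorm \<mu> p2 g \<le> A * (2 powr (real_of_int k * p1)) powr \<delta> * l k powr (1 / p1 - \<delta>)"
          using good_part_bound [of h k "l k" A g, OF h l(1) [unfolded N_def] l(2) _ bg(3)] A(1) by auto
        have "s k * Eseminorm \<mu> p2 g \<le> s k * (A * (2 powr (real_of_int k * p1)) powr \<delta> * l k powr (1 / p1 - \<delta>))"
          using g(2) spos by (intro mult_left_mono) (auto simp: less_imp_le)
        also have "\<dots> = A * (l k powr \<delta> * l k powr (1 / p1 - \<delta>))"
          using l(2) [of k] by (simp add: s_def powr_divide)
        also have "\<dots> = A * l k powr (1 / p1)"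
          by (simp add: powr_add [symmetric])
        finally have "Eseminorm \<mu> (ereal p1) b + s k * Eseminorm \<mu> p2 g \<le> 2 * A * l k powr (1 / p1)"
          using b(2) by simp
        moreover have "?F = abs_fun_mod_const b + abs_fun_mod_const g"
          using bg(1) by (simp add: plus_fun_mod_const.abs_eq fun_eq_iff [symmetric]) (metis ext)
        ultimately show ?thesis
          using b(1) g(1) by (intro bexI [of _ "abs_fun_mod_const b"] bexI [of _ "abs_fun_mod_const g"])
            (auto simp: abs_in_Wspace_iff Wnorm.abs_eq)
      qed
      have sum: "\<exists>a0\<in>W1. \<exists>a1\<in>W2. ?F = a0 + a1" using dec [of 0] by blast
      have K_dec: "K ?F (s k) \<le> 2 * A * l k powr (1 / p1)" for k
        using dec [of k] K_le [of _ _ "s k"] spos [of k] by (force intro: order_trans)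
      have "interp_int ?F \<le> ennreal B * (\<integral>\<^sup>+k. ennreal (l k * 2 powr (real_of_int k * (p - p1))) \<partial>count_space UNIV)"
        unfolding interp_integral_def B_def
      proof (rule K_integral_dyadic_bound)
        show "l k \<le> l j" if "j \<le> k" for j k
          using truncated_moment_antimono [of h N j k, OF h N(2) that] l(1) l(2) [of j] by (simp add: less_imp_le)
        show "l k \<le> 2 powr N * l (k + 1)" for k
          using truncated_moment_Suc [of h N k, OF h N(2)] l(1) l(2) [of "k + 1"]
          by (simp add: ennreal_mult [symmetric] less_imp_le)
        show "K ?F ((l k / 2 powr (real_of_int k * p1)) powr \<delta>) \<le> 2 * A * l k powr (1 / p1)" for k
          using K_dec [of k] by (simp add: s_def)
      qed (use sum K_mono K_nonneg l(2) p1 \<delta>_pos \<theta>_nonneg \<theta> A(1) in auto)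
      also have "(\<integral>\<^sup>+k. ennreal (l k * 2 powr (real_of_int k * (p - p1))) \<partial>count_space UNIV)
        = (\<integral>\<^sup>+k. truncated_moment N h k * ennreal (2 powr (real_of_int k * (p - p1))) \<partial>count_space UNIV)"
        using l(2) by (intro nn_integral_cong) (simp add: l(1) ennreal_mult less_imp_le)
      also have "ennreal B * \<dots> \<le> ennreal B * (ennreal C * (ennreal A * moment \<mu> p (grad \<mu> f)))"
        using moment_h by (intro mult_left_mono order_trans [OF C(2) [of h, OF h]]) auto
      also have "\<dots> = ennreal (B * C * A) * moment \<mu> p (grad \<mu> f)"
        using A C B by (simp add: ennreal_mult mult.assoc)
      finally show ?thesis using sum by blast
    qed
  qed
qed

end

theorem corollary1p18:
  fixes \<mu> :: "'a \<Rightarrow> 'a \<Rightarrow> real"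
    and \<alpha> q p1 p \<theta> :: real
    and p2 :: ereal
  assumes "weighted_graph \<mu>"
    and "doubling \<mu>"
    and "1 \<le> q" and "poincare \<mu> q"
    and "\<alpha> > 0" and "Delta_cond \<mu> \<alpha>"
    and "poincare_inf \<mu> < p1" and "p1 < p" and "ereal p < p2"
    and "1 / ereal p = ereal (1 - \<theta>) / ereal p1 + ereal \<theta> / p2"
  shows "equal_with_equivalent_norms
           (Wspace \<mu> (ereal p)) (Wnorm \<mu> (ereal p))
           (interp_space (Wspace \<mu> (ereal p1)) (Wnorm \<mu> (ereal p1))
                         (Wspace \<mu> p2) (Wnorm \<mu> p2) \<theta> p)
           (interp_norm (Wspace \<mu> (ereal p1)) (Wnorm \<mu> (ereal p1))
                        (Wspace \<mu> p2) (Wnorm \<mu> p2) \<theta> p)"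
proof -
  interpret weighted_graph \<mu> by fact
  \<comment> \<open>The infimum may not be attained, but some exponent of the set lies below p1; it
    also yields 1 < p1.\<close>
  obtain s where s: "1 \<le> s" "poincare \<mu> s" "s < p1"
    using cInf_lessD [of "{q. 1 \<le> q \<and> poincare \<mu> q}" p1] assms(3,4,7) by (auto simp: poincare_inf_def)
  define \<delta> where "\<delta> = 1 / p1 - (if p2 = \<infinity> then 0 else 1 / real_of_ereal p2)"
  have inv_p: "1 / ereal p = ereal (1 / p)"
    using assms(8) s by (simp add: one_ereal_def)
  have \<theta>: "\<theta> * \<delta> = 1 / p1 - 1 / p"
  proof (cases p2)
    case (real r)
    then have "1 / p = (1 - \<theta>) / p1 + \<theta> / r"
      using assms(8-10) s inv_p by simp
    then show ?thesis using real by (simp add: \<delta>_def right_diff_distrib diff_divide_distrib)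
  next
    case PInf
    then have "1 / p = (1 - \<theta>) / p1"
      using assms(8-10) s inv_p by simp
    then show ?thesis using PInf by (simp add: \<delta>_def diff_divide_distrib)
  qed (use assms in auto)
  interpret sobolev_interpolation \<mu> p1 p \<theta> \<delta> p2
    by unfold_locales (use assms s \<theta> in \<open>auto simp: \<delta>_def\<close>)
  obtain C where C: "C > 0" "\<And>f. moment \<mu> p (grad \<mu> f) < \<infinity> \<Longrightarrow>
    (\<exists>a0\<in>W1. \<exists>a1\<in>W2. abs_fun_mod_const f = a0 + a1) \<and>
    interp_int (abs_fun_mod_const f) \<le> ennreal C * moment \<mu> p (grad \<mu> f)"
    using interp_integral_le_moment_grad [OF assms(2,6,5) s(2,1,3)] by blast
  define D where "D = 4 * 2 powr (1 / \<delta>) * 4 powr p"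
  have D: "D > 0" by (simp add: D_def)
  let ?W = "Wspace \<mu> (ereal p)" and ?I = "interp_space W1 M1 W2 M2 \<theta> p"
  have p: "p > 0" using p1 by simp
  have iff: "abs_fun_mod_const f \<in> ?W \<longleftrightarrow> moment \<mu> p (grad \<mu> f) < \<infinity>" for f
    by (simp add: abs_in_Wspace_iff Espace_ereal_iff)
  have sub1: "F \<in> ?I" if "F \<in> ?W" for F
  proof -
    obtain f where f: "F = abs_fun_mod_const f" by (rule fun_mod_const_cases)
    then have fin: "moment \<mu> p (grad \<mu> f) < \<infinity>" using that iff by simp
    show ?thesis
      unfolding interp_space_def using C(2) [OF fin] fin f
      by (auto simp: ennreal_mult_less_top intro: order.strict_trans1)
  qed
  have sub2: "F \<in> ?W" if "F \<in> ?I" for F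
  proof -
    obtain f where f: "F = abs_fun_mod_const f" by (rule fun_mod_const_cases)
    have "moment \<mu> p (grad \<mu> f) \<le> ennreal D * interp_int F"
      using that f moment_grad_le_interp_integral [of f] by (auto simp: interp_space_def D_def)
    also have "\<dots> < \<infinity>" using that by (simp add: interp_space_def ennreal_mult_less_top)
    finally show ?thesis using iff f by simp
  qed
  \<comment> \<open>Passes from moments to norms. Finiteness of b matters because
    \<open>enn2real\<close> sends \<infinity> to 0.\<close>
  have root: "enn2real a powr (1 / p) \<le> c powr (1 / p) * enn2real b powr (1 / p)"
    if le: "a \<le> ennreal c * b" and b: "b < \<infinity>" and c: "c > 0" for a b c
  proof -
    obtain b' where b': "b = ennreal b'" "b' \<ge> 0" using b by (cases b) auto
    have "enn2real a \<le> c * b'"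
      using le c b' by (intro enn2real_leI) (auto simp: ennreal_mult)
    then have "enn2real a powr (1 / p) \<le> (c * b') powr (1 / p)"
      using p by (intro powr_mono2) auto
    then show ?thesis using c b' by (simp add: powr_mult)
  qed
  show ?thesis
    unfolding equal_with_equivalent_norms_def
  proof (intro conjI exI [of _ "max (C powr (1 / p)) (D powr (1 / p))"] ballI)
    show "?W = ?I" using sub1 sub2 by blast
    show "max (C powr (1 / p)) (D powr (1 / p)) > 0" using C(1) by (simp add: less_max_iff_disj)
    fix F assume F: "F \<in> ?W"
    obtain f where f: "F = abs_fun_mod_const f" by (rule fun_mod_const_cases)
    have fin: "moment \<mu> p (grad \<mu> f) < \<infinity>" using F f iff by simp
    have finI: "interp_int F < \<infinity>" using sub1 [OF F] by (simp add: interp_space_def)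
    have W: "Wnorm \<mu> (ereal p) F = enn2real (moment \<mu> p (grad \<mu> f)) powr (1 / p)"
      using fin f by (simp add: Wnorm.abs_eq Eseminorm_ereal Espace_ereal_iff)
    have "Wnorm \<mu> (ereal p) F \<le> D powr (1 / p) * interp_norm W1 M1 W2 M2 \<theta> p F"
      unfolding W interp_norm_def
    proof (rule root [OF _ finI D])
      show "moment \<mu> p (grad \<mu> f) \<le> ennreal D * interp_int F"
        using C(2) [OF fin] finI f moment_grad_le_interp_integral [of f] by (simp add: D_def)
    qed
    also have "\<dots> \<le> max (C powr (1 / p)) (D powr (1 / p)) * interp_norm W1 M1 W2 M2 \<theta> p F"
      by (intro mult_right_mono) (auto simp: interp_norm_def)
    finally show "Wnorm \<mu> (ereal p) F \<le> \<dots>" .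
    have "interp_norm W1 M1 W2 M2 \<theta> p F \<le> C powr (1 / p) * Wnorm \<mu> (ereal p) F"
      unfolding W interp_norm_def using C(2) [OF fin] f by (intro root [OF _ fin C(1)]) auto
    also have "\<dots> \<le> max (C powr (1 / p)) (D powr (1 / p)) * Wnorm \<mu> (ereal p) F"
      by (intro mult_right_mono) (auto simp: W)
    finally show "interp_norm W1 M1 W2 M2 \<theta> p F \<le> \<dots>" .
  qed
qed

end
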